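(* Let $\mathcal M_A,\mathcal M_B$ be commuting von Neumann algebras on a Hilbert space $\mathcal H$. The following are equivalent: (a) Haag duality: $\mathcal M_A=\mathcal M_B'$; (b) if $\Psi,\Phi\in\mathcal H$ are unit vectors with $\psi_A=\phi_A$, then $\Psi=v_B\Phi$ for a partial isometry $v_B\in\mathcal M_B$; (c) if $\Psi,\Phi\in\mathcal H$ are unit vectors with $\psi_A=\phi_A$, then for all $\varepsilon>0$ there exists a unitary $u_B\in\mathcal M_B$ such that $\|\Psi-u_B\Phi\|<\varepsilon$.
   Context: Hilbert spaces are separable. For a vector $\Psi\in\mathcal H$, $\psi_A$ denotes the marginal $\psi_A(a)=\langle\Psi,a\Psi\rangle$, $a\in\mathcal M_A$; similarly $\phi_A$ for $\Phi$. $\mathcal M_B'$ is the commutant of $\mathcal M_B$ in $B(\mathcal H)$. *)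

theory Defs
  imports "HOL-Analysis.Analysis"
begin

section \<open>Complex Hilbert spaces\<close>

text \<open>
  A complex inner product space is a real inner product space, whose real inner product is the real
  part of the sesquilinear form, so that norm, metric and topology are the library's and positive
  definiteness is inherited. The form is antilinear in its \<^emph>\<open>first\<close> argument.
\<close>

class complex_inner = real_inner +
  fixes scaleC :: "complex \<Rightarrow> 'a \<Rightarrow> 'a"  (infixr "*\<^sub>C" 75)
    and cinner :: "'a \<Rightarrow> 'a \<Rightarrow> complex"
  assumes scaleC_add_right: "c *\<^sub>C (x + y) = c *\<^sub>C x + c *\<^sub>C y"
    and scaleC_add_left: "(c + d) *\<^sub>C x = c *\<^sub>C x + d *\<^sub>C x"
    and scaleC_scaleC: "c *\<^sub>C (d *\<^sub>C x) = (c * d) *\<^sub>C x"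
    and scaleR_scaleC: "r *\<^sub>R x = complex_of_real r *\<^sub>C x"
    and cinner_commute: "cinner x y = cnj (cinner y x)"
    and cinner_add_right: "cinner x (y + z) = cinner x y + cinner x z"
    and cinner_scaleC_right: "cinner x (c *\<^sub>C y) = c * cinner x y"
    and inner_eq_Re_cinner: "inner x y = Re (cinner x y)"

class chilbert_space = complex_inner + complete_space
begin
subclass banach ..
end


section \<open>Bounded operators\<close>

definition bounded_operators :: "('h::complex_inner \<Rightarrow> 'h) set" where
  "bounded_operators = {a. bounded_linear a \<and> (\<forall>c x. a (c *\<^sub>C x) = c *\<^sub>C a x)}"

text \<open>
  As for \<^const>\<open>adjoint\<close>, the adjoint is chosen by its defining property; existence for bounded
  operators on a Hilbert space is \<open>cinner_cadjoint\<close> below.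
\<close>

definition cadjoint :: "('h::complex_inner \<Rightarrow> 'h) \<Rightarrow> 'h \<Rightarrow> 'h" where
  "cadjoint a = (SOME b. \<forall>x y. cinner (b x) y = cinner x (a y))"

definition is_projection :: "('h::complex_inner \<Rightarrow> 'h) \<Rightarrow> bool" where
  "is_projection p \<longleftrightarrow> p \<in> bounded_operators \<and> cadjoint p = p \<and> p \<circ> p = p"

definition is_partial_isometry :: "('h::complex_inner \<Rightarrow> 'h) \<Rightarrow> bool" where
  "is_partial_isometry v \<longleftrightarrow> v \<in> bounded_operators \<and> is_projection (cadjoint v \<circ> v)"

definition is_unitary :: "('h::complex_inner \<Rightarrow> 'h) \<Rightarrow> bool" where
  "is_unitary u \<longleftrightarrow> u \<in> bounded_operators \<and> cadjoint u \<circ> u = id \<and> u \<circ> cadjoint u = id"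


section \<open>Von Neumann algebras\<close>

definition commutant :: "('h::complex_inner \<Rightarrow> 'h) set \<Rightarrow> ('h \<Rightarrow> 'h) set" where
  "commutant S = {x \<in> bounded_operators. \<forall>a\<in>S. x \<circ> a = a \<circ> x}"

definition unital_star_subalgebra :: "('h::complex_inner \<Rightarrow> 'h) set \<Rightarrow> bool" where
  "unital_star_subalgebra M \<longleftrightarrow>
     M \<subseteq> bounded_operators \<and> id \<in> M \<and>
     (\<forall>a\<in>M. \<forall>b\<in>M. (\<lambda>x. a x + b x) \<in> M \<and> a \<circ> b \<in> M) \<and>
     (\<forall>a\<in>M. (\<forall>c. (\<lambda>x. c *\<^sub>C a x) \<in> M) \<and> cadjoint a \<in> M)"

definition von_neumann_algebra :: "('h::complex_inner \<Rightarrow> 'h) set \<Rightarrow> bool" where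
  "von_neumann_algebra M \<longleftrightarrow> unital_star_subalgebra M \<and> commutant (commutant M) = M"

text \<open>
  The marginal is a functional on \<open>M\<close> only; \<^const>\<open>restrict\<close> makes its values outside \<open>M\<close> irrelevant
  to equality.
\<close>

definition marginal :: "('h::complex_inner \<Rightarrow> 'h) set \<Rightarrow> 'h \<Rightarrow> ('h \<Rightarrow> 'h) \<Rightarrow> complex" where
  "marginal M \<Psi> = (\<lambda>a\<in>M. cinner \<Psi> (a \<Psi>))"


section \<open>Existence of adjoints\<close>

lemma riesz_real:
  fixes f :: "'h::chilbert_space \<Rightarrow> real"
  assumes "bounded_linear f"
  shows "\<exists>z. \<forall>x. f x = inner z x"
proof -
  interpret f: bounded_linear f by fact
  obtain K where K: "\<And>x. norm (f x) \<le> norm x * K" using f.bounded by blast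
  define J where "J x = inner x x - 2 * f x" for x
  have J_ge: "J x \<ge> - (K\<^sup>2)" for x
  proof -
    have "f x \<le> norm x * K" using K[of x] by simp
    moreover have "(norm x - K)\<^sup>2 \<ge> 0" by simp
    ultimately show ?thesis
      unfolding J_def by (simp add: power2_eq_square algebra_simps dot_square_norm)
  qed
  define m where "m = (INF x. J x)"
  have bdd: "bdd_below (range J)" using J_ge by (auto intro!: bdd_belowI)
  have m_le: "m \<le> J x" for x unfolding m_def by (rule cINF_lower[OF bdd]) simp
  have "\<exists>x. J x < m + 1 / Suc n" for n
  proof -
    have "(INF x. J x) < m + 1 / Suc n" unfolding m_def by simp
    then show ?thesis using cINF_less_iff[OF _ bdd] by auto
  qed
  then obtain s where s: "\<And>n. J (s n) < m + 1 / Suc n" by metis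
  have par: "J x + J y = 2 * J ((1/2) *\<^sub>R (x + y)) + (norm (x - y))\<^sup>2 / 2" for x y
    unfolding J_def power2_norm_eq_inner f.scaleR f.add
    by (simp add: inner_add_left inner_add_right inner_diff_left inner_diff_right inner_commute[of y x] field_simps)
  have dist_s: "(norm (s n - s k))\<^sup>2 < 2 / Suc n + 2 / Suc k" for n k
    using par[of "s n" "s k"] s[of n] s[of k] m_le[of "(1/2) *\<^sub>R (s n + s k)"] by simp
  have "Cauchy s"
  proof (rule metric_CauchyI)
    fix e :: real assume e: "e > 0"
    obtain N :: nat where N: "4 / e\<^sup>2 < real N" using reals_Archimedean2 by blast
    show "\<exists>M. \<forall>n\<ge>M. \<forall>k\<ge>M. dist (s n) (s k) < e"
    proof (intro exI allI impI)
      fix n k assume nk: "n \<ge> N" "k \<ge> N"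
      have "0 < 4 / e\<^sup>2" using e by simp
      then have N0: "0 < real N" using N by linarith
      have "4 / real N < e\<^sup>2" using N N0 e by (simp add: field_simps)
      moreover have "2 / Suc n \<le> 2 / real N" "2 / Suc k \<le> 2 / real N"
        using nk N0 by (auto intro!: divide_left_mono)
      ultimately have "(norm (s n - s k))\<^sup>2 < e\<^sup>2" using dist_s[of n k] by simp
      then show "dist (s n) (s k) < e" using e by (simp add: dist_norm power2_less_imp_less)
    qed
  qed
  then obtain z where z: "s \<longlonglongrightarrow> z" using Cauchy_convergent convergent_def by blast
  have "(\<lambda>n. J (s n)) \<longlonglongrightarrow> J z"
    unfolding J_def
    by (intro tendsto_diff tendsto_inner tendsto_mult tendsto_const f.tendsto z)
  moreover have "(\<lambda>n. m + 1 / Suc n) \<longlonglongrightarrow> m + 0"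
    by (rule tendsto_add[OF tendsto_const LIMSEQ_inverse_real_of_nat[unfolded inverse_eq_divide]])
  ultimately have "J z \<le> m + 0"
    by (rule LIMSEQ_le) (use s less_imp_le in blast)
  then have Jz: "J z \<le> m" by simp
  have "f x = inner z x" for x
  proof (rule ccontr)
    assume ne: "f x \<noteq> inner z x"
    define d where "d = f x - inner z x"
    have x0: "inner x x > 0" using ne by (cases "x = 0") (auto simp: f.zero)
    define t where "t = d / inner x x"
    have "J (z + t *\<^sub>R x) = J z - 2 * t * d + t\<^sup>2 * inner x x"
      unfolding J_def d_def f.scaleR f.add
      by (simp add: inner_add_left inner_add_right inner_commute[of x z] algebra_simps power2_eq_square)
    also have "\<dots> = J z - d\<^sup>2 / inner x x"
      using x0 by (simp add: t_def power2_eq_square field_simps)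
    also have "\<dots> < J z" using x0 ne by (simp add: d_def)
    finally show False using m_le[of "z + t *\<^sub>R x"] Jz by simp
  qed
  then show ?thesis by blast
qed

lemma cinner_cadjoint:
  fixes a :: "'h::chilbert_space \<Rightarrow> 'h"
  assumes a: "a \<in> bounded_operators"
  shows "cinner (cadjoint a x) y = cinner x (a y)"
proof -
  have lin: "bounded_linear a" and cl: "\<And>c x. a (c *\<^sub>C x) = c *\<^sub>C a x"
    using a by (auto simp: bounded_operators_def)
  have "\<exists>z. \<forall>y. cinner z y = cinner x (a y)" for x
  proof -
    have "bounded_linear (\<lambda>y. inner x (a y))"
      using bounded_linear_compose[OF bounded_linear_inner_right lin] .
    then obtain z where z: "\<And>y. inner x (a y) = inner z y" using riesz_real by blast
    have "cinner z y = cinner x (a y)" for y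
      using z[of y] z[of "\<i> *\<^sub>C y"]
      by (simp add: complex_eq_iff inner_eq_Re_cinner cl cinner_scaleC_right)
    then show ?thesis by blast
  qed
  then have "\<exists>b. \<forall>x y. cinner (b x) y = cinner x (a y)" by metis
  then show ?thesis unfolding cadjoint_def by (rule someI2_ex) blast
qed

end

theory Submission
  imports Defs
begin

text \<open>
  If Haag duality holds and \<open>\<Psi>\<close>, \<open>\<Phi>\<close> have equal marginals, then \<open>a \<Phi> \<mapsto> a \<Psi>\<close> extends to a partial
  isometry \<open>v\<close> in \<open>M\<^sub>A' = M\<^sub>B\<close>. For \<open>r < 1\<close> the strict contraction \<open>r v\<close> is approximately an average of
  unitaries \<open>u\<close> of \<open>M\<^sub>B\<close>. Since \<open>v \<Phi>\<close> is a unit vector, one of the unit vectors \<open>u \<Phi>\<close> must be close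
  to it.

  Conversely, let \<open>u\<close> be a unitary of \<open>M\<^sub>A'\<close>. The vectors \<open>u \<eta>\<close> and \<open>\<eta>\<close> have the same marginal, so
  \<open>u \<eta>\<close> is a limit of vectors \<open>b \<eta>\<close> with contractions \<open>b\<close> in \<open>M\<^sub>B\<close>. For \<open>r\<close> in \<open>M\<^sub>B'\<close> this gives
  \<open>\<parallel>r u \<eta>\<parallel> \<le> \<parallel>r \<eta>\<parallel>\<close>, with equality because \<open>u\<^sup>*\<close> satisfies the same bound. Hence \<open>u\<close> commutes with
  \<open>r\<^sup>* r\<close> for all \<open>r\<close> in \<open>M\<^sub>B'\<close>, so with \<open>M\<^sub>B'\<close> by polarization, that is, \<open>u\<close> is in \<open>M\<^sub>B\<close>. Finally,
  the Cayley transform shows that \<open>M\<^sub>A'\<close> is generated by its unitaries.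
\<close>

section \<open>Sesquilinear forms and adjoints\<close>

lemma cinner_add_left: "cinner (x + y) z = cinner x z + cinner (y::'a::complex_inner) z"
  by (metis cinner_add_right cinner_commute complex_cnj_add)

lemma cinner_scaleC_left: "cinner (c *\<^sub>C x) y = cnj c * cinner (x::'a::complex_inner) y"
  by (metis cinner_commute cinner_scaleC_right complex_cnj_mult)

text \<open>Lifts identities of the real inner product to the complex form, whose imaginary part is
  recovered from the real part at \<open>\<i> *\<^sub>C y\<close>.\<close>

lemma cinner_eqI:
  fixes x y :: "'a::complex_inner"
  assumes "inner x y = inner x' y'" "inner x (\<i> *\<^sub>C y) = inner x' (\<i> *\<^sub>C y')"
  shows "cinner x y = cinner x' y'"
  using assms by (simp add: inner_eq_Re_cinner cinner_scaleC_right complex_eq_iff)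

lemma cinner_self: "cinner x x = complex_of_real ((norm (x::'a::complex_inner))\<^sup>2)"
proof -
  have "cinner x x = cnj (cinner x x)" by (rule cinner_commute)
  then have "Im (cinner x x) = 0" by (metis complex_cnj cnj.simps(2) complex.sel(2) equal_neg_zero)
  then show ?thesis
    by (simp add: complex_eq_iff power2_norm_eq_inner inner_eq_Re_cinner)
qed

lemma norm_scaleC [simp]: "norm (c *\<^sub>C x) = cmod c * norm (x::'a::complex_inner)"
proof -
  have "complex_of_real ((norm (c *\<^sub>C x))\<^sup>2) = (c * cnj c) * cinner x x"
    by (simp only: cinner_self[symmetric] cinner_scaleC_left cinner_scaleC_right mult.assoc)
  also have "\<dots> = complex_of_real ((cmod c * norm x)\<^sup>2)"
    by (simp only: complex_norm_square[symmetric] cinner_self power_mult_distrib of_real_mult)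
  finally show ?thesis by (simp only: of_real_eq_iff power2_eq_iff_nonneg norm_ge_zero mult_nonneg_nonneg)
qed

lemma scaleC_zero_left [simp]: "0 *\<^sub>C (x::'a::complex_inner) = 0"
  by (simp flip: norm_eq_zero)

lemma scaleC_zero_right [simp]: "c *\<^sub>C (0::'a::complex_inner) = 0"
  by (subst norm_eq_zero[symmetric]) simp

lemma scaleC_one [simp]: "1 *\<^sub>C (x::'a::complex_inner) = x"
  using scaleR_scaleC[of 1 x] by simp

lemma scaleC_minus_right [simp]: "c *\<^sub>C (- x) = - (c *\<^sub>C (x::'a::complex_inner))"
  by (metis add.right_inverse add_eq_0_iff scaleC_add_right scaleC_zero_right)

lemma scaleC_minus_left: "(- c) *\<^sub>C x = - (c *\<^sub>C (x::'a::complex_inner))"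
  by (metis add.right_inverse add_eq_0_iff scaleC_add_left scaleC_zero_left)

lemma scaleC_sum_right: "c *\<^sub>C sum f A = (\<Sum>a\<in>A. c *\<^sub>C (f a :: 'a::complex_inner))"
  by (induction A rule: infinite_finite_induct) (auto simp: scaleC_add_right)

lemma scaleC_sum_left: "sum f A *\<^sub>C (x :: 'a::complex_inner) = (\<Sum>a\<in>A. f a *\<^sub>C x)"
  by (induction A rule: infinite_finite_induct) (auto simp: scaleC_add_left)

lemma cinner_zero_right [simp]: "cinner (x::'a::complex_inner) 0 = 0"
  using cinner_scaleC_right[of x 0 0] by simp

lemma cinner_minus_right: "cinner x (- y) = - cinner x (y::'a::complex_inner)"
  using cinner_add_right[of x y "- y"] by (simp add: minus_unique)

lemma cinner_diff_right: "cinner x (y - z) = cinner x y - cinner x (z::'a::complex_inner)"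
  using cinner_add_right[of x y "- z"] by (simp add: cinner_minus_right)

lemma cinner_diff_left: "cinner (x - y) z = cinner x z - cinner (y::'a::complex_inner) z"
  by (metis cinner_commute cinner_diff_right complex_cnj_diff)

lemma cinner_ext:
  fixes x y :: "'a::complex_inner"
  assumes "\<And>z. cinner x z = cinner y z"
  shows "x = y"
proof -
  have "cinner (x - y) (x - y) = 0" using assms by (simp add: cinner_diff_left)
  then show ?thesis by (simp add: cinner_self)
qed

section \<open>Bounded complex-linear operators\<close>

lemma bounded_operatorsI:
  fixes f :: "'a::complex_inner \<Rightarrow> 'a"
  assumes "\<And>x y. f (x + y) = f x + f y" "\<And>c x. f (c *\<^sub>C x) = c *\<^sub>C f x"
    "\<And>x. norm (f x) \<le> K * norm x"
  shows "f \<in> bounded_operators"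
  unfolding bounded_operators_def
  by (auto intro!: bounded_linear_intro[where K = K] simp: assms scaleR_scaleC mult.commute[of _ K])

lemma bounded_operators_bound:
  assumes "f \<in> bounded_operators"
  obtains K where "K > 0" "\<And>x. norm (f x) \<le> K * norm x"
  using assms bounded_linear.pos_bounded[of f] unfolding bounded_operators_def
  by (metis (no_types, lifting) mem_Collect_eq mult.commute)

lemma
  assumes "f \<in> bounded_operators"
  shows op_add: "f (x + y) = f x + f y"
    and op_diff: "f (x - y) = f x - f y"
    and op_minus: "f (- x) = - f x"
    and op_zero: "f 0 = 0"
    and op_scaleC: "f (c *\<^sub>C x) = c *\<^sub>C f x"
    and op_scaleR: "f (r *\<^sub>R x) = r *\<^sub>R f x"
    and op_sum: "f (sum g A) = (\<Sum>a\<in>A. f (g a))"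
    and op_bounded_linear: "bounded_linear f"
proof -
  show "bounded_linear f" using assms by (simp add: bounded_operators_def)
  then interpret bounded_linear f .
  show "f (x + y) = f x + f y" "f (x - y) = f x - f y" "f (- x) = - f x" "f 0 = 0"
     "f (r *\<^sub>R x) = r *\<^sub>R f x" "f (sum g A) = (\<Sum>a\<in>A. f (g a))"
    by (simp_all add: add diff neg zero scaleR sum)
  show "f (c *\<^sub>C x) = c *\<^sub>C f x" using assms by (simp add: bounded_operators_def)
qed

lemma id_bounded_operators: "id \<in> bounded_operators"
  by (rule bounded_operatorsI[where K = 1]) auto

lemma bounded_operators_add:
  assumes "f \<in> bounded_operators" "g \<in> bounded_operators"
  shows "(\<lambda>x. f x + g x) \<in> bounded_operators"
  using assms unfolding bounded_operators_def by (auto intro: bounded_linear_add simp: scaleC_add_right)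

lemma bounded_operators_comp:
  assumes "f \<in> bounded_operators" "g \<in> bounded_operators"
  shows "f \<circ> g \<in> bounded_operators"
  using assms unfolding bounded_operators_def
  by (auto intro: bounded_linear_compose simp: o_def)

lemma bounded_operators_scaleC:
  fixes f :: "'a::complex_inner \<Rightarrow> 'a"
  assumes "f \<in> bounded_operators"
  shows "(\<lambda>x. c *\<^sub>C f x) \<in> bounded_operators"
proof -
  obtain K where K: "\<And>x. norm (f x) \<le> K * norm x"
    using bounded_operators_bound[OF assms] by blast
  show ?thesis
    by (rule bounded_operatorsI[where K = "cmod c * K"])
       (use K in \<open>auto simp: op_add[OF assms] op_scaleC[OF assms] scaleC_add_right scaleC_scaleC
          mult.commute[of c] mult.assoc intro!: mult_left_mono\<close>)
qed

lemma bounded_operators_funpow: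
  "f \<in> bounded_operators \<Longrightarrow> f ^^ n \<in> bounded_operators"
  by (induction n) (auto intro: bounded_operators_comp id_bounded_operators)

section \<open>Adjoints of bounded operators\<close>

lemma cinner_cadjoint_right:
  fixes a :: "'h::chilbert_space \<Rightarrow> 'h"
  assumes "a \<in> bounded_operators"
  shows "cinner x (cadjoint a y) = cinner (a x) y"
  by (metis assms cinner_cadjoint cinner_commute)

lemma inner_cadjoint:
  fixes a :: "'h::chilbert_space \<Rightarrow> 'h"
  assumes "a \<in> bounded_operators"
  shows "inner (cadjoint a x) y = inner x (a y)"
  by (simp add: inner_eq_Re_cinner cinner_cadjoint assms)

text \<open>The way to compute the \<open>SOME\<close> in \<open>cadjoint\<close>: \<open>b\<close>
  witnesses that the choice is possible, and nondegeneracy of the form leaves no other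
  candidate.\<close>

lemma cadjoint_unique:
  fixes a :: "'h::complex_inner \<Rightarrow> 'h"
  assumes "\<And>x y. cinner (b x) y = cinner x (a y)"
  shows "cadjoint a = b"
proof -
  have "\<forall>x y. cinner (cadjoint a x) y = cinner x (a y)"
    unfolding cadjoint_def by (rule someI[of _ b]) (use assms in blast)
  with assms show ?thesis by (intro ext cinner_ext) simp
qed

lemma cadjoint_bounded_operators:
  fixes a :: "'h::chilbert_space \<Rightarrow> 'h"
  assumes a: "a \<in> bounded_operators"
  shows "cadjoint a \<in> bounded_operators"
proof -
  obtain K where K: "K > 0" "\<And>x. norm (a x) \<le> K * norm x"
    using bounded_operators_bound[OF a] by blast
  show ?thesis
  proof (rule bounded_operatorsI[where K = K])
    fix x y :: 'h and c
    show "cadjoint a (x + y) = cadjoint a x + cadjoint a y"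
      by (rule cinner_ext) (simp add: cinner_cadjoint a cinner_add_left)
    show "cadjoint a (c *\<^sub>C x) = c *\<^sub>C cadjoint a x"
      by (rule cinner_ext) (simp add: cinner_cadjoint a cinner_scaleC_left)
    let ?y = "cadjoint a x"
    have "norm ?y * norm ?y = inner x (a ?y)"
      using inner_cadjoint[OF a, of x ?y] by (simp flip: power2_norm_eq_inner power2_eq_square)
    also have "\<dots> \<le> norm x * norm (a ?y)" by (rule norm_cauchy_schwarz)
    also have "\<dots> \<le> norm x * (K * norm ?y)" by (intro mult_left_mono K) auto
    finally have "norm ?y * norm ?y \<le> (K * norm x) * norm ?y" by (simp add: ac_simps)
    then show "norm ?y \<le> K * norm x" using K(1) by (cases "norm ?y = 0") auto
  qed
qed

lemma cadjoint_cadjoint: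
  fixes a :: "'h::chilbert_space \<Rightarrow> 'h"
  assumes "a \<in> bounded_operators"
  shows "cadjoint (cadjoint a) = a"
  by (rule cadjoint_unique) (simp add: assms cinner_cadjoint_right)

lemma cadjoint_comp:
  fixes a b :: "'h::chilbert_space \<Rightarrow> 'h"
  assumes "a \<in> bounded_operators" "b \<in> bounded_operators"
  shows "cadjoint (a \<circ> b) = cadjoint b \<circ> cadjoint a"
  by (rule cadjoint_unique) (simp add: assms cinner_cadjoint)

section \<open>Projections, partial isometries, unitaries and perturbations of the identity\<close>

lemma norm_projection_le:
  fixes p :: "'h::chilbert_space \<Rightarrow> 'h"
  assumes "is_projection p"
  shows "norm (p x) \<le> norm x"
proof -
  have p: "p \<in> bounded_operators" "cadjoint p = p" "p (p x) = p x"
    using assms by (auto simp: is_projection_def fun_eq_iff)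
  have "norm (p x) * norm (p x) = inner x (p x)"
    using inner_cadjoint[OF p(1), of x "p x"] p
    by (simp flip: power2_norm_eq_inner power2_eq_square)
  also have "\<dots> \<le> norm x * norm (p x)" by (rule norm_cauchy_schwarz)
  finally show ?thesis by (cases "norm (p x) = 0") auto
qed

text \<open>With the projection p = v* v, both squared norms equal the inner product of p x with
  x.\<close>

lemma norm_partial_isometry:
  fixes v :: "'h::chilbert_space \<Rightarrow> 'h"
  assumes "is_partial_isometry v"
  shows "norm (v x) = norm (cadjoint v (v x))"
proof -
  let ?p = "cadjoint v \<circ> v"
  have v: "v \<in> bounded_operators" and p: "is_projection ?p"
    using assms by (auto simp: is_partial_isometry_def)
  have p': "?p \<in> bounded_operators" "cadjoint ?p = ?p" "?p (?p x) = ?p x"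
    using p unfolding is_projection_def fun_eq_iff by auto
  have "inner (v x) (v x) = inner (?p x) x"
    by (simp add: inner_cadjoint v)
  also have "\<dots> = inner (?p (?p x)) x" using p'(3) by simp
  also have "\<dots> = inner (?p x) (?p x)"
    using inner_cadjoint[OF p'(1), of "?p x" x] p'(2) by simp
  finally show ?thesis by (simp add: norm_eq_sqrt_inner)
qed

lemma norm_partial_isometry_le:
  fixes v :: "'h::chilbert_space \<Rightarrow> 'h"
  assumes "is_partial_isometry v"
  shows "norm (v x) \<le> norm x"
  using norm_partial_isometry[OF assms, of x] norm_projection_le[of "cadjoint v \<circ> v" x] assms
  by (simp add: is_partial_isometry_def)

lemma cinner_unitary:
  fixes u :: "'h::chilbert_space \<Rightarrow> 'h"
  assumes "is_unitary u"
  shows "cinner (u x) (u y) = cinner x y"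
proof -
  have "u \<in> bounded_operators" "cadjoint u (u x) = x"
    using assms unfolding is_unitary_def fun_eq_iff by auto
  then show ?thesis by (metis cinner_cadjoint)
qed

lemma norm_unitary:
  fixes u :: "'h::chilbert_space \<Rightarrow> 'h"
  assumes "is_unitary u"
  shows "norm (u x) = norm x"
  using cinner_unitary[OF assms, of x x] by (simp add: norm_eq_sqrt_inner inner_eq_Re_cinner)

lemma is_unitary_cadjoint:
  fixes u :: "'h::chilbert_space \<Rightarrow> 'h"
  assumes "is_unitary u"
  shows "is_unitary (cadjoint u)"
  using assms by (simp add: is_unitary_def cadjoint_bounded_operators cadjoint_cadjoint)

text \<open>Polarization and complex linearity turn preservation of the norm into preservation of
  the form. Hence the adjoint is a left inverse, and surjectivity makes it two-sided.\<close>

lemma is_unitaryI: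
  fixes u :: "'h::chilbert_space \<Rightarrow> 'h"
  assumes add: "\<And>x y. u (x + y) = u x + u y" and scale: "\<And>c x. u (c *\<^sub>C x) = c *\<^sub>C u x"
    and norm: "\<And>x. norm (u x) = norm x" and "surj u"
  shows "is_unitary u"
proof -
  have u: "u \<in> bounded_operators"
    by (rule bounded_operatorsI[where K = 1]) (simp_all add: assms)
  have inner: "inner (u x) (u y) = inner x y" for x y
    using norm[of "x + y"] norm[of x] norm[of y]
    by (simp add: dot_norm add[symmetric])
  have cinner: "cinner (u x) (u y) = cinner x y" for x y
    by (rule cinner_eqI) (simp_all add: inner scale[symmetric])
  have inj: "cadjoint u (u x) = x" for x
    by (rule cinner_ext) (simp add: cinner_cadjoint u cinner)
  moreover have "u (cadjoint u y) = y" for y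
    using \<open>surj u\<close> inj by (metis surjD)
  ultimately show ?thesis by (auto simp: is_unitary_def u fun_eq_iff)
qed

text \<open>Surjectivity is Banach's fixed point theorem for \<open>\<lambda>x. y + T x\<close>. A
  vector in the kernel is fixed by \<open>T\<close>, so its norm is at most \<open>r\<close> times
  itself.\<close>

lemma bij_id_minus_contraction:
  fixes T :: "'h::chilbert_space \<Rightarrow> 'h"
  assumes T: "T \<in> bounded_operators" and r: "0 \<le> r" "r < 1" "\<And>x. norm (T x) \<le> r * norm x"
  shows "bij (\<lambda>x. x - T x)"
proof (rule bijI)
  have "x = 0" if "x = T x" for x
  proof -
    have "norm x \<le> r * norm x" using r(3)[of x] that by simp
    then have "(1 - r) * norm x \<le> 0" by (simp add: algebra_simps)
    then show ?thesis using r by (simp add: mult_le_0_iff)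
  qed
  then show "inj (\<lambda>x. x - T x)"
    by (intro injI) (metis (no_types, lifting) T add_diff_cancel_left' add_diff_eq diff_diff_eq2
        eq_iff_diff_eq_0 op_diff)
  have "\<exists>x. y = x - T x" for y
  proof -
    have "\<forall>a b. dist (y + T a) (y + T b) \<le> r * dist a b"
      using r(3) by (simp add: dist_norm op_diff[OF T, symmetric])
    then obtain x where "y + T x = x"
      using banach_fix_type[OF r(1,2), of "\<lambda>x. y + T x"] by blast
    then show ?thesis by (metis add_diff_cancel_right')
  qed
  then show "surj (\<lambda>x. x - T x)" unfolding surj_def by blast
qed

section \<open>Von Neumann algebras\<close>

lemma
  assumes "von_neumann_algebra M"
  shows vn_bounded: "a \<in> M \<Longrightarrow> a \<in> bounded_operators"
    and vn_id: "id \<in> M"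
    and vn_add: "a \<in> M \<Longrightarrow> b \<in> M \<Longrightarrow> (\<lambda>x. a x + b x) \<in> M"
    and vn_comp: "a \<in> M \<Longrightarrow> b \<in> M \<Longrightarrow> a \<circ> b \<in> M"
    and vn_scaleC: "a \<in> M \<Longrightarrow> (\<lambda>x. c *\<^sub>C a x) \<in> M"
    and vn_cadjoint: "a \<in> M \<Longrightarrow> cadjoint a \<in> M"
  using assms unfolding von_neumann_algebra_def unital_star_subalgebra_def by blast+

lemma vn_diff:
  assumes "von_neumann_algebra M" "a \<in> M" "b \<in> M"
  shows "(\<lambda>x. a x - b x) \<in> M"
  using vn_add[OF assms(1,2) vn_scaleC[OF assms(1,3), of "-1"]]
  by (simp add: scaleC_minus_left)

text \<open>The bicommutant property stands in for closure in an operator topology: membership is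
  tested by commuting with the commutant.\<close>

lemma vn_memI:
  assumes "von_neumann_algebra M" "x \<in> bounded_operators"
    "\<And>y \<xi>. y \<in> commutant M \<Longrightarrow> x (y \<xi>) = y (x \<xi>)"
  shows "x \<in> M"
proof -
  have "x \<in> commutant (commutant M)"
    using assms(2,3) by (auto simp: commutant_def fun_eq_iff)
  then show ?thesis using assms(1) by (simp add: von_neumann_algebra_def)
qed

lemma commutantD:
  assumes "x \<in> commutant S"
  shows "x \<in> bounded_operators" "a \<in> S \<Longrightarrow> x (a \<xi>) = a (x \<xi>)"
  using assms unfolding commutant_def fun_eq_iff by auto

text \<open>The bicommutant condition is immediate from that of \<open>M\<close>, so the work is
  algebraic closure. For adjoints: \<open>a\<close> commutes with the adjoint of each
  \<open>b\<close> in \<open>M\<close>, and passing to adjoints, \<open>cadjoint a\<close> commutes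
  with \<open>b\<close>.\<close>

lemma von_neumann_algebra_commutant:
  fixes M :: "('h::chilbert_space \<Rightarrow> 'h) set"
  assumes "von_neumann_algebra M"
  shows "von_neumann_algebra (commutant M)"
proof -
  have mem: "x \<in> commutant M" if "x \<in> bounded_operators" "\<And>a \<xi>. a \<in> M \<Longrightarrow> x (a \<xi>) = a (x \<xi>)" for x
    using that unfolding commutant_def fun_eq_iff by auto
  note ops = op_add op_diff op_scaleC
  have "unital_star_subalgebra (commutant M)"
    unfolding unital_star_subalgebra_def
  proof (intro conjI ballI allI)
    fix a b c assume a: "a \<in> commutant M" and b: "b \<in> commutant M"
    note a' = commutantD[OF a] and b' = commutantD[OF b]
    show "(\<lambda>x. a x + b x) \<in> commutant M" "a \<circ> b \<in> commutant M" "(\<lambda>x. c *\<^sub>C a x) \<in> commutant M"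
      using a' b' vn_bounded[OF assms]
      by (auto intro!: mem bounded_operators_add bounded_operators_comp bounded_operators_scaleC
          simp: ops)
  next
    fix a assume a: "a \<in> commutant M"
    note a' = commutantD[OF a]
    show "cadjoint a \<in> commutant M"
    proof (intro mem cadjoint_bounded_operators a' cinner_ext)
      fix b \<xi> z assume b: "b \<in> M"
      note b' = vn_bounded[OF assms b] and bs = vn_cadjoint[OF assms b]
      have "cinner (cadjoint a (b \<xi>)) z = cinner \<xi> (cadjoint b (a z))"
        by (simp add: cinner_cadjoint cinner_cadjoint_right a' b')
      also have "\<dots> = cinner \<xi> (a (cadjoint b z))" using a'(2)[OF bs] by simp
      also have "\<dots> = cinner (b (cadjoint a \<xi>)) z"
        by (simp add: cinner_cadjoint[OF a'(1), symmetric] cinner_cadjoint_right b')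
      finally show "cinner (cadjoint a (b \<xi>)) z = cinner (b (cadjoint a \<xi>)) z" .
    qed
  qed (auto intro: mem id_bounded_operators simp: commutantD)
  then show ?thesis using assms by (simp add: von_neumann_algebra_def)
qed

text \<open>The quotient \<open>A \<circ> inv B\<close> is isometric by the equality of norms, and
  whatever commutes with \<open>A\<close> and \<open>B\<close> commutes with it. Cayley and Moebius
  transforms are both obtained this way.\<close>

lemma unitary_quotient:
  fixes M :: "('h::chilbert_space \<Rightarrow> 'h) set"
  assumes M: "von_neumann_algebra M" and AB: "A \<in> M" "B \<in> M"
    and "surj A" "bij B" and norm: "\<And>x. norm (A x) = norm (B x)"
  obtains u where "u \<in> M" "is_unitary u" "\<And>x. u (B x) = A x"
proof -
  let ?u = "A \<circ> inv B"
  have uB: "?u (B x) = A x" for x using \<open>bij B\<close> by (simp add: bij_is_inj)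
  have surjB: "\<exists>x'. x = B x'" for x using \<open>bij B\<close> by (metis bij_pointE)
  note [simp] = uB
  note A = vn_bounded[OF M AB(1)] and B = vn_bounded[OF M AB(2)]
  have un: "is_unitary ?u"
  proof (rule is_unitaryI)
    fix x y c
    obtain x' y' where xy: "x = B x'" "y = B y'" using surjB by metis
    have "?u (B (x' + y')) = A x' + A y'" by (simp only: uB op_add[OF A])
    then show "?u (x + y) = ?u x + ?u y" by (simp only: uB op_add[OF B] xy)
    have "?u (B (c *\<^sub>C x')) = c *\<^sub>C A x'" by (simp only: uB op_scaleC[OF A])
    then show "?u (c *\<^sub>C x) = c *\<^sub>C ?u x" by (simp only: uB op_scaleC[OF B] xy)
    show "norm (?u x) = norm x" by (simp only: uB xy norm)
  next
    show "surj ?u" by (rule comp_surj[OF bij_is_surj[OF bij_imp_bij_inv[OF \<open>bij B\<close>]] \<open>surj A\<close>])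
  qed
  have "?u \<in> M"
  proof (rule vn_memI[OF M])
    show "?u \<in> bounded_operators" using un by (simp add: is_unitary_def)
    fix y \<xi> assume y: "y \<in> commutant M"
    obtain \<eta> where \<eta>: "\<xi> = B \<eta>" using surjB by metis
    have "?u (y (B \<eta>)) = ?u (B (y \<eta>))" using commutantD(2)[OF y AB(2)] by simp
    also have "\<dots> = y (?u (B \<eta>))" using commutantD(2)[OF y AB(1)] by (simp only: uB)
    finally show "?u (y \<xi>) = y (?u \<xi>)" by (simp only: \<eta>)
  qed
  with un uB that show ?thesis by blast
qed

section \<open>Von Neumann algebras are generated by their unitaries\<close>

text \<open>The Cayley transform u = (1 + T) (1 - T)^-1 of a small imaginary multiple T of
  \<open>h\<close> is a unitary of \<open>M\<close>, hence in \<open>N\<close>; \<open>h\<close> is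
  recovered from u + 1 = 2 (1 - T)^-1.\<close>

lemma selfadjoint_mem_if_unitaries_subset:
  fixes M N :: "('h::chilbert_space \<Rightarrow> 'h) set"
  assumes M: "von_neumann_algebra M" and N: "von_neumann_algebra N"
    and unitaries: "\<And>u. u \<in> M \<Longrightarrow> is_unitary u \<Longrightarrow> u \<in> N"
    and h: "h \<in> M" "cadjoint h = h"
  shows "h \<in> N"
proof (rule vn_memI[OF N])
  show hb: "h \<in> bounded_operators" by (rule vn_bounded[OF M h(1)])
  then obtain K where K: "K > 0" "\<And>x. norm (h x) \<le> K * norm x"
    by (rule bounded_operators_bound) blast
  \<comment> \<open>The factor \<i> makes \<open>T\<close> skew-adjoint; dividing by 2 K makes it a
    contraction with constant 1/2, so that 1 + T and 1 - T are bijective.\<close>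
  define c where "c = \<i> * complex_of_real (1 / (2 * K))"
  have c0: "c \<noteq> 0" using K(1) by (simp add: c_def)
  define T where "T = (\<lambda>x. c *\<^sub>C h x)"
  define A where "A = (\<lambda>x. x + T x)"
  define B where "B = (\<lambda>x. x - T x)"
  have T: "T \<in> M" unfolding T_def by (rule vn_scaleC[OF M h(1)])
  note Tb = vn_bounded[OF M T]
  have A_eq: "A = (\<lambda>x. x - (- T x))" by (simp add: A_def)
  have mT: "(\<lambda>x. - T x) \<in> M"
    using vn_scaleC[OF M T, of "-1"] by (simp add: scaleC_minus_left)
  have AB: "A \<in> M" "B \<in> M"
    using vn_add[OF M vn_id[OF M] T] vn_diff[OF M vn_id[OF M] T] by (simp_all add: A_def B_def)
  have normT: "norm (T x) \<le> 1/2 * norm x" for x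
  proof -
    have nc: "cmod c = 1 / (2 * K)" using K(1) by (simp add: c_def norm_mult norm_divide)
    then show ?thesis using K(2)[of x] K(1) unfolding T_def norm_scaleC nc by (simp add: field_simps)
  qed
  have bij: "bij B" "bij A"
    unfolding B_def A_eq
    by (rule bij_id_minus_contraction[where r = "1/2"];
        use normT Tb vn_bounded[OF M mT] in simp)+
  \<comment> \<open>Self-adjointness makes \<open>cinner x (h x)\<close> real, so its imaginary
    multiple has real part 0. By Pythagoras, x + T x and x - T x then have the same norm.\<close>
  have ortho: "inner x (T x) = 0" for x
  proof -
    have "cinner x (h x) = cnj (cinner x (h x))"
      using cinner_cadjoint[OF hb, of x x] cinner_commute[of "h x" x] h(2) by simp
    then have "Im (cinner x (h x)) = 0" by (metis cnj.simps(2) equal_neg_zero)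
    then show ?thesis by (simp add: inner_eq_Re_cinner T_def c_def cinner_scaleC_right)
  qed
  have "norm (A x) = norm (B x)" for x
    using ortho[of x]
    by (simp add: A_def B_def norm_eq_sqrt_inner inner_add_left inner_add_right
        inner_diff_left inner_diff_right inner_commute[of "T x" x])
  then obtain u where u: "u \<in> M" "is_unitary u" and uB: "\<And>x. u (B x) = A x"
    using unitary_quotient[OF M AB bij_is_surj[OF bij(2)] bij(1)] by blast
  fix y \<xi> assume y: "y \<in> commutant N"
  note yb = commutantD(1)[OF y]
  have "y (u x) = u (y x)" for x using commutantD(2)[OF y unitaries[OF u]] .
  note yu = this
  \<comment> \<open>As \<open>y\<close> commutes with u, it commutes with u + 1, which is twice the
    inverse of \<open>B\<close>. Hence the preimage \<eta> must be y \<xi>.\<close>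
  obtain \<eta> where \<eta>: "B \<eta> = y (B \<xi>)" using bij_is_surj[OF bij(1)] by (metis surjD)
  have sum: "u (B x) + B x = 2 *\<^sub>R x" for x
    unfolding uB by (simp add: A_def B_def scaleR_2)
  have "2 *\<^sub>R \<eta> = u (y (B \<xi>)) + y (B \<xi>)" using sum[of \<eta>] \<eta> by simp
  also have "\<dots> = y (u (B \<xi>) + B \<xi>)" by (simp add: yu op_add[OF yb])
  also have "\<dots> = 2 *\<^sub>R y \<xi>" by (simp add: sum op_scaleR[OF yb])
  finally have "B (y \<xi>) = y (B \<xi>)" using \<eta> by simp
  then have "c *\<^sub>C h (y \<xi>) = c *\<^sub>C y (h \<xi>)"
    by (simp add: B_def T_def op_diff[OF yb] op_scaleC[OF yb])
  then have "inverse c *\<^sub>C c *\<^sub>C h (y \<xi>) = inverse c *\<^sub>C c *\<^sub>C y (h \<xi>)" by (rule arg_cong)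
  then show "h (y \<xi>) = y (h \<xi>)" by (simp add: scaleC_scaleC c0)
qed

lemma subset_if_unitaries_subset:
  fixes M N :: "('h::chilbert_space \<Rightarrow> 'h) set"
  assumes M: "von_neumann_algebra M" and N: "von_neumann_algebra N"
    and unitaries: "\<And>u. u \<in> M \<Longrightarrow> is_unitary u \<Longrightarrow> u \<in> N"
  shows "M \<subseteq> N"
proof
  fix x assume x: "x \<in> M"
  note xb = vn_bounded[OF M x] and xs = vn_cadjoint[OF M x]
  define h where "h = (\<lambda>\<xi>. x \<xi> + cadjoint x \<xi>)"
  define k where "k = (\<lambda>\<xi>. \<i> *\<^sub>C (x \<xi> - cadjoint x \<xi>))"
  have "h \<in> M" unfolding h_def by (rule vn_add[OF M x xs])
  moreover have "cadjoint h = h"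
    by (rule cadjoint_unique)
      (simp add: h_def cinner_add_left cinner_add_right cinner_cadjoint cinner_cadjoint_right xb)
  ultimately have h: "h \<in> N"
    using selfadjoint_mem_if_unitaries_subset[OF M N] unitaries by blast
  have "k \<in> M" unfolding k_def by (intro vn_scaleC[OF M] vn_diff[OF M] x xs)
  moreover have "cadjoint k = k"
    by (rule cadjoint_unique)
      (simp add: k_def cinner_diff_left cinner_diff_right cinner_scaleC_left cinner_scaleC_right
        cinner_cadjoint cinner_cadjoint_right xb algebra_simps)
  ultimately have k: "k \<in> N"
    using selfadjoint_mem_if_unitaries_subset[OF M N] unitaries by blast
  have "(\<lambda>\<xi>. (1/2) *\<^sub>C (h \<xi> + (- \<i>) *\<^sub>C k \<xi>)) \<in> N"
    by (intro vn_scaleC[OF N] vn_add[OF N] h k)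
  moreover have "(1/2) *\<^sub>C (h \<xi> + (- \<i>) *\<^sub>C k \<xi>) = x \<xi>" for \<xi>
  proof -
    have "h \<xi> + (- \<i>) *\<^sub>C k \<xi> = 2 *\<^sub>R x \<xi>"
      by (simp add: h_def k_def scaleC_scaleC scaleR_2)
    then show ?thesis by (simp add: scaleR_scaleC scaleC_scaleC)
  qed
  ultimately show "x \<in> N" by simp
qed

section \<open>Approximation of unitaries forces Haag duality\<close>

text \<open>The norm condition says that conjugation by \<open>u\<close> fixes every r* r. Comparing
  1 + r, r and 1 shows that it fixes r + r*, and using \<i> r as well, that it fixes r.\<close>

lemma commutes_if_norms_preserved:
  fixes N :: "('h::chilbert_space \<Rightarrow> 'h) set"
  assumes N: "von_neumann_algebra N" and u: "is_unitary u"
    and norm: "\<And>r \<eta>. r \<in> N \<Longrightarrow> norm (r (u \<eta>)) = norm (r \<eta>)"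
    and r: "r \<in> N"
  shows "u (r \<eta>) = r (u \<eta>)"
proof -
  have ub: "u \<in> bounded_operators" using u by (simp add: is_unitary_def)
  have inner: "inner (r (u x)) (r (u y)) = inner (r x) (r y)" if "r \<in> N" for r x y
  proof -
    note rb = vn_bounded[OF N that]
    show ?thesis
      using norm[OF that, of "x + y"] norm[OF that, of x] norm[OF that, of y]
      by (simp add: dot_norm op_add[OF ub] op_add[OF rb])
  qed
  have sum: "inner (u x) (r (u y)) + inner (r (u x)) (u y) = inner x (r y) + inner (r x) y"
    if r: "r \<in> N" for r x y
    using inner[OF vn_add[OF N vn_id[OF N] r], of x y] inner[OF r, of x y]
      inner[OF vn_id[OF N], of x y]
    by (simp add: inner_add_left inner_add_right)
  have Re: "inner (u x) (r (u y)) = inner x (r y)" for x y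
  proof -
    have ir: "(\<lambda>x. \<i> *\<^sub>C r x) \<in> N" by (rule vn_scaleC[OF N r])
    note rb = vn_bounded[OF N r]
    have "inner (\<i> *\<^sub>C a) b = - inner a (\<i> *\<^sub>C b)" "inner (\<i> *\<^sub>C a) (\<i> *\<^sub>C b) = inner a b" for a b :: 'h
      by (simp_all add: inner_eq_Re_cinner cinner_scaleC_left cinner_scaleC_right)
    note ii = this
    have "\<i> *\<^sub>C \<i> *\<^sub>C z = - z" for z :: 'h by (simp add: scaleC_scaleC scaleC_minus_left)
    note iz = this
    \<comment> \<open>Replacing r by \<i> r and y by - \<i> y flips the sign of the second summand
      on each side of \<open>sum\<close>; adding the two identities leaves twice the first.\<close>
    show ?thesis
      using sum[OF r, of x y] sum[OF ir, of x "- (\<i> *\<^sub>C y)"]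
      by (simp add: op_minus[OF ub] op_minus[OF rb] op_scaleC[OF ub] op_scaleC[OF rb] ii iz)
  qed
  have "inner (u x) (r (u \<eta>) - u (r \<eta>)) = 0" for x
  proof -
    have "inner (u x) (u (r \<eta>)) = inner x (r \<eta>)"
      using cinner_unitary[OF u] by (simp add: inner_eq_Re_cinner)
    then show ?thesis using Re by (simp add: inner_diff_right)
  qed
  \<comment> \<open>By surjectivity of \<open>u\<close>, the difference is itself of the form u x,
    so it is orthogonal to itself.\<close>
  moreover have "u (cadjoint u z) = z" for z using u unfolding is_unitary_def fun_eq_iff by simp
  ultimately have "inner (r (u \<eta>) - u (r \<eta>)) (r (u \<eta>) - u (r \<eta>)) = 0" by metis
  then show ?thesis by simp
qed

text \<open>Contractions are what partial isometries and unitaries have in common, so one lemma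
  serves both converses. An \<open>r\<close> in \<open>commutant N\<close> moves past such a
  \<open>b\<close>, so the norm of r (b \<eta>) is at most that of r \<eta>; the bound survives the
  limit in which b \<eta> tends to u \<eta>.\<close>

lemma commutant_subset_if_approximable:
  fixes M N :: "('h::chilbert_space \<Rightarrow> 'h) set"
  assumes M: "von_neumann_algebra M" and N: "von_neumann_algebra N"
    and approx: "\<And>\<Psi> \<Phi> \<epsilon>. norm \<Psi> = 1 \<Longrightarrow> norm \<Phi> = 1 \<Longrightarrow> marginal M \<Psi> = marginal M \<Phi> \<Longrightarrow> \<epsilon> > 0
      \<Longrightarrow> \<exists>b\<in>N. (\<forall>x. norm (b x) \<le> norm x) \<and> norm (\<Psi> - b \<Phi>) < \<epsilon>"
  shows "commutant M \<subseteq> N"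
proof (rule subset_if_unitaries_subset[OF von_neumann_algebra_commutant[OF M] N])
  note N' = von_neumann_algebra_commutant[OF N] and M' = von_neumann_algebra_commutant[OF M]
  have unit: "norm (r (u \<eta>)) \<le> norm (r \<eta>)"
    if u: "u \<in> commutant M" "is_unitary u" and r: "r \<in> commutant N" and \<eta>: "norm \<eta> = 1"
    for u r \<eta>
  proof (rule field_le_epsilon)
    fix e :: real assume "e > 0"
    note rb = commutantD(1)[OF r]
    obtain K where K: "K > 0" "\<And>x. norm (r x) \<le> K * norm x"
      using bounded_operators_bound[OF rb] by blast
    have "cinner (u \<eta>) (a (u \<eta>)) = cinner \<eta> (a \<eta>)" if "a \<in> M" for a
      using commutantD(2)[OF u(1) that, of \<eta>] cinner_unitary[OF u(2), of \<eta> "a \<eta>"] by simp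
    then have "marginal M (u \<eta>) = marginal M \<eta>"
      unfolding marginal_def by (intro restrict_ext) simp
    \<comment> \<open>The precision e / K is chosen so that applying \<open>r\<close>, with bound K,
      costs at most e.\<close>
    then obtain b where b: "b \<in> N" "\<And>x. norm (b x) \<le> norm x" "norm (u \<eta> - b \<eta>) < e / K"
      using approx[of "u \<eta>" \<eta> "e / K"] norm_unitary[OF u(2)] \<eta> \<open>e > 0\<close> K(1) by auto
    have "norm (r (u \<eta>)) \<le> norm (r (b \<eta>)) + norm (r (u \<eta> - b \<eta>))"
      unfolding op_diff[OF rb] by (metis norm_triangle_sub)
    moreover have "norm (r (b \<eta>)) \<le> norm (r \<eta>)"
      using commutantD(2)[OF r b(1)] b(2) by simp
    moreover have "norm (r (u \<eta> - b \<eta>)) \<le> e"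
      using K(2)[of "u \<eta> - b \<eta>"] b(3) K(1) by (simp add: field_simps)
    ultimately show "norm (r (u \<eta>)) \<le> norm (r \<eta>) + e" by linarith
  qed
  have le: "norm (r (u \<eta>)) \<le> norm (r \<eta>)"
    if u: "u \<in> commutant M" "is_unitary u" and r: "r \<in> commutant N" for u r \<eta>
  proof (cases "\<eta> = 0")
    case True
    then show ?thesis using op_zero[OF commutantD(1)[OF u(1)]] by simp
  next
    case False
    have "norm (r (u (sgn \<eta>))) \<le> norm (r (sgn \<eta>))"
      by (rule unit[OF that]) (simp add: False norm_sgn)
    then show ?thesis
      using False by (simp add: sgn_div_norm op_scaleR[OF commutantD(1)[OF u(1)]]
          op_scaleR[OF commutantD(1)[OF r]])
  qed
  fix u assume u: "u \<in> commutant M" "is_unitary u"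
  have "norm (r (u \<eta>)) = norm (r \<eta>)" if r: "r \<in> commutant N" for r \<eta>
  proof (rule antisym[OF le[OF u r]])
    have "cadjoint u (u \<eta>) = \<eta>" using u unfolding is_unitary_def fun_eq_iff by simp
    then show "norm (r \<eta>) \<le> norm (r (u \<eta>))"
      using le[OF vn_cadjoint[OF M' u(1)] is_unitary_cadjoint[OF u(2)] r, of "u \<eta>"] by simp
  qed
  then show "u \<in> N"
    using commutes_if_norms_preserved[OF N' u(2)]
    by (intro vn_memI[OF N]) (auto simp: commutantD(1)[OF u(1)])
qed

section \<open>Partial isometries approximated by unitaries on a vector\<close>

text \<open>Multiplication by a primitive root w permutes the roots and multiplies the sum by w^m,
  which is not 1. This is the discrete form of the vanishing circle integral.\<close>

lemma sum_power_roots_of_unity: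
  assumes "0 < m" "m < n"
  shows "(\<Sum>z | z ^ n = 1. z ^ m) = (0::complex)"
proof -
  define w where "w = exp (2 * of_real pi * \<i> * of_nat 1 / of_nat n)"
  have wn: "w ^ n = 1" unfolding w_def by (rule complex_root_unity) (use assms in simp)
  have "w ^ m = exp (2 * of_real pi * \<i> * of_nat m / of_nat n)"
    unfolding w_def by (simp add: exp_of_nat_mult[symmetric] mult_ac)
  then have wm: "w ^ m \<noteq> 1"
    using complex_root_unity_eq_1[of n m] assms by (simp add: nat_dvd_not_less)
  have "w \<noteq> 0" by (simp add: w_def)
  have "(\<Sum>z | z ^ n = 1. z ^ m) = (\<Sum>z | z ^ n = 1. (w * z) ^ m)"
    by (rule sum.reindex_bij_witness[where i = "\<lambda>z. w * z" and j = "\<lambda>z. z / w"])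
      (auto simp: power_mult_distrib power_divide wn \<open>w \<noteq> 0\<close>)
  also have "\<dots> = w ^ m * (\<Sum>z | z ^ n = 1. z ^ m)"
    by (simp add: power_mult_distrib sum_distrib_left)
  finally show ?thesis using wm by (simp add: mult_cancel_right1)
qed

text \<open>The hypothesis makes w - p orthogonal to p, so only the component p is stretched, by 1 +
  c.\<close>

lemma norm2_add_scaled_projection:
  fixes w p :: "'a::real_inner"
  assumes "inner w p = (norm p)\<^sup>2"
  shows "(norm (w + c *\<^sub>R p))\<^sup>2 = (norm w)\<^sup>2 + ((1 + c)\<^sup>2 - 1) * (norm p)\<^sup>2"
  using assms unfolding power2_norm_eq_inner
  by (simp add: inner_add_left inner_add_right inner_commute[of p w] power2_eq_square algebra_simps)

section \<open>A partial isometry in a von Neumann algebra and its Moebius transforms\<close>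

context
  fixes M :: "('h::chilbert_space \<Rightarrow> 'h) set" and v :: "'h \<Rightarrow> 'h"
  assumes M: "von_neumann_algebra M" and v: "v \<in> M" "is_partial_isometry v"
begin

lemma partial_isometry_bounded: "v \<in> bounded_operators"
  and partial_isometry_cadjoint_mem: "cadjoint v \<in> M"
  and partial_isometry_cadjoint_bounded: "cadjoint v \<in> bounded_operators"
  using vn_bounded[OF M] vn_cadjoint[OF M] v by auto

text \<open>Since v* v is idempotent it kills x - v* v x, and by
  \<open>norm_partial_isometry\<close> so does v. The other identity is the adjoint of this
  one.\<close>

lemma partial_isometry_star_id: "cadjoint v (v (cadjoint v x)) = cadjoint v x"
  and partial_isometry_id: "v (cadjoint v (v x)) = v x"
proof -
  note b = partial_isometry_bounded partial_isometry_cadjoint_bounded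
  have p: "cadjoint v (v (cadjoint v (v x))) = cadjoint v (v x)" for x
    using v(2) unfolding is_partial_isometry_def is_projection_def fun_eq_iff by simp
  have "norm (v (x - cadjoint v (v x))) = norm (cadjoint v (v (x - cadjoint v (v x))))" for x
    by (rule norm_partial_isometry[OF v(2)])
  also have "\<dots> x = 0" for x by (simp add: op_diff[OF b(1)] op_diff[OF b(2)] p)
  finally show *: "v (cadjoint v (v x)) = v x" for x by (simp add: op_diff[OF b(1)])
  show "cadjoint v (v (cadjoint v x)) = cadjoint v x"
  proof (rule cinner_ext)
    show "cinner (cadjoint v (v (cadjoint v x))) z = cinner (cadjoint v x) z" for z
      using * by (simp add: cinner_cadjoint[OF b(1)] cinner_cadjoint_right[OF b(1), symmetric])
  qed
qed

lemma norm_partial_isometry_cadjoint_le: "norm (cadjoint v x) \<le> norm x"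
proof -
  have "norm (cadjoint v x) * norm (cadjoint v x) = inner x (v (cadjoint v x))"
    using inner_cadjoint[OF partial_isometry_bounded, of x "cadjoint v x"]
    by (simp flip: power2_norm_eq_inner power2_eq_square)
  also have "\<dots> \<le> norm x * norm (v (cadjoint v x))" by (rule norm_cauchy_schwarz)
  also have "\<dots> \<le> norm x * norm (cadjoint v x)"
    by (intro mult_left_mono norm_partial_isometry_le v) simp
  finally show ?thesis by (cases "norm (cadjoint v x) = 0") auto
qed

text \<open>
  The operator Moebius transform of the scalar unitary \<open>z\<close> at the strict contraction \<open>x = r v\<close>,
  \<open>(1 - x x\<^sup>*)\<^bsup>-1/2\<^esup> (x + z) (1 + z x\<^sup>*)\<^bsup>-1\<^esup> (1 - x\<^sup>* x)\<^bsup>1/2\<^esup>\<close>, is unitary. As \<open>v\<^sup>* v\<close> and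
  \<open>v v\<^sup>*\<close> are projections, the square roots are explicit. Its average over \<open>|z| = 1\<close> is \<open>x\<close>.
\<close>

lemma moebius_unitary:
  fixes r :: real and z :: complex
  assumes r: "0 \<le> r" "r < 1" and z: "cmod z = 1"
    and \<Phi>: "cadjoint v (v \<Phi>) = \<Phi>"
    and y: "y + r *\<^sub>R z *\<^sub>C cadjoint v y = \<Phi>"
  obtains u where "u \<in> M" "is_unitary u"
    "inner (v \<Phi>) (u \<Phi>) = r * (norm (v \<Phi>))\<^sup>2 + (1 - r\<^sup>2) * inner (v \<Phi>) (z *\<^sub>C y)"
proof -
  note b = partial_isometry_bounded partial_isometry_cadjoint_bounded
  define s where "s = sqrt (1 - r\<^sup>2)"
  have r2: "r\<^sup>2 < 1" using r by (simp add: power_less_one_iff)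
  have s: "s > 0" "s\<^sup>2 = 1 - r\<^sup>2" using r2 by (auto simp: s_def)
  \<comment> \<open>On the ranges of v* v and v v*, the square roots of 1 - x* x and 1 - x x* are
    multiplication by \<open>s\<close>. So \<open>P c\<close> and \<open>Q c\<close>, which stretch
    these ranges by 1 + c = 1 / s, are the inverse square roots; \<open>B1\<close> is 1 + z x* and
    \<open>A1\<close> is x + z.\<close>
  define c where "c = 1 / s - 1"
  define B1 where "B1 = (\<lambda>w. w + r *\<^sub>R z *\<^sub>C cadjoint v w)"
  define A1 where "A1 = (\<lambda>w. r *\<^sub>R v w + z *\<^sub>C w)"
  define P where "P = (\<lambda>c w. w + c *\<^sub>R cadjoint v (v w))"
  define Q where "Q = (\<lambda>c w. w + c *\<^sub>R v (cadjoint v w))"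
  note opv = op_add[OF b(1)] op_add[OF b(2)] op_scaleR[OF b(1)] op_scaleR[OF b(2)]
    op_scaleC[OF b(1)] op_scaleC[OF b(2)] partial_isometry_star_id partial_isometry_id
  have scaleR: "(\<lambda>w. a *\<^sub>R f w) \<in> M" if "f \<in> M" for a f
    using vn_scaleC[OF M that, of "complex_of_real a"] by (simp add: scaleR_scaleC)
  have vv: "(\<lambda>w. cadjoint v (v w)) \<in> M" "(\<lambda>w. v (cadjoint v w)) \<in> M"
    using vn_comp[OF M partial_isometry_cadjoint_mem v(1)] vn_comp[OF M v(1) partial_isometry_cadjoint_mem] by (simp_all add: o_def)
  have idM: "(\<lambda>w. w) \<in> M" using vn_id[OF M] by (simp add: id_def)
  have mem: "P c \<in> M" "Q c \<in> M" "B1 \<in> M" "A1 \<in> M"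
    unfolding P_def Q_def B1_def A1_def
    by (intro vn_add[OF M] scaleR vn_scaleC[OF M] idM vv v partial_isometry_cadjoint_mem)+
  have inv: "(1 + c) * s = 1" using s by (simp add: c_def)
  \<comment> \<open>For idempotent p, composing 1 + a p with 1 + b p gives 1 + (a + b + a b) p. The
    vanishing coefficient makes the parameters c and s - 1 inverse to each other.\<close>
  have c': "c + (s - 1) + c * (s - 1) = 0" using inv by (simp add: algebra_simps)
  have bijPQ: "bij (P c)" "bij (Q c)"
  proof -
    have "a *\<^sub>R x + (b *\<^sub>R x + (a * b) *\<^sub>R x) = (a + b + a * b) *\<^sub>R x" for a b and x :: 'h
      by (simp add: scaleR_add_left)
    note comb = this
    have c'': "(s - 1) + c + (s - 1) * c = 0" using c' by (simp add: algebra_simps)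
    have "P c (P (s - 1) w) = w" "P (s - 1) (P c w) = w"
      "Q c (Q (s - 1) w) = w" "Q (s - 1) (Q c w) = w" for w
      unfolding P_def Q_def opv
      using comb[of c "cadjoint v (v w)" "s - 1"] comb[of "s - 1" "cadjoint v (v w)" c]
        comb[of c "v (cadjoint v w)" "s - 1"] comb[of "s - 1" "v (cadjoint v w)" c] c' c''
      by (simp_all add: scaleR_add_right add.assoc add.left_commute)
    then show "bij (P c)" "bij (Q c)"
      by (auto intro: o_bij[of "P (s - 1)" "P c"] o_bij[of "Q (s - 1)" "Q c"] simp: fun_eq_iff)
  qed
  have bijB1: "bij B1"
  proof -
    have "B1 = (\<lambda>w. w - r *\<^sub>R (- z) *\<^sub>C cadjoint v w)" by (simp add: B1_def scaleC_minus_left)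
    moreover have "bij \<dots>"
      by (rule bij_id_minus_contraction[where r = r])
        (use r z norm_partial_isometry_cadjoint_le in \<open>auto intro!: vn_bounded[OF M] vn_scaleC[OF M] scaleR partial_isometry_cadjoint_mem mult_left_mono\<close>)
    ultimately show ?thesis by simp
  qed
  \<comment> \<open>Multiplied by the unimodular \<open>cnj z\<close>, \<open>A1\<close> becomes the
    identity plus a strict contraction.\<close>
  have surjA1: "surj A1"
  proof -
    have "bij (\<lambda>w. w - (- cnj z) *\<^sub>C r *\<^sub>R v w)"
      by (rule bij_id_minus_contraction[where r = r])
        (use r z norm_partial_isometry_le[OF v(2)] in
          \<open>auto intro!: vn_bounded[OF M] vn_scaleC[OF M] scaleR v mult_left_mono\<close>)
    then have "\<exists>w. cnj z *\<^sub>C x = w - (- cnj z) *\<^sub>C r *\<^sub>R v w" for x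
      by (rule surjD[OF bij_is_surj])
    moreover have zz: "z * cnj z = 1" using z complex_norm_square[of z] by simp
    have "x = A1 w" if "cnj z *\<^sub>C x = w - (- cnj z) *\<^sub>C r *\<^sub>R v w" for x w
    proof -
      have "z *\<^sub>C cnj z *\<^sub>C x = A1 w"
        unfolding that by (simp add: A1_def scaleC_add_right scaleC_minus_left scaleC_scaleC zz)
      then show ?thesis by (simp add: scaleC_scaleC zz)
    qed
    ultimately show ?thesis unfolding surj_def by blast
  qed
  define A where "A = Q c \<circ> A1"
  define B where "B = P c \<circ> B1"
  have AB: "A \<in> M" "B \<in> M" unfolding A_def B_def by (intro vn_comp[OF M] mem)+
  have bij: "surj A" "bij B" unfolding A_def B_def
    by (rule comp_surj[OF surjA1 bij_is_surj[OF bijPQ(2)]], rule bij_comp[OF bijB1 bijPQ(1)])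
  have inner_z: "inner (z *\<^sub>C x) (z *\<^sub>C x') = inner x x'" for x x' :: 'h
    using z complex_norm_square[of z]
    by (simp add: inner_eq_Re_cinner cinner_scaleC_left cinner_scaleC_right mult.assoc[symmetric] mult.commute)
  have i1: "inner (v a) a' = inner a (cadjoint v a')" for a a'
    by (simp add: inner_cadjoint[OF b(1), symmetric] inner_commute)
  \<comment> \<open>In the difference of the squared norms the cross terms \<open>?m\<close> cancel.
    What remains is a multiple of the difference between the squared norms of v w and v* w, with
    coefficient 0 because (1 + c)^2 (1 - r^2) = 1.\<close>
  have norm_eq: "norm (A w) = norm (B w)" for w
  proof -
    let ?m = "inner w (z *\<^sub>C cadjoint v w)" and ?k = "(1 + c)\<^sup>2 - 1"
    note n2 = power2_norm_eq_inner
    have nB1: "(norm (B1 w))\<^sup>2 = (norm w)\<^sup>2 + r\<^sup>2 * (norm (cadjoint v w))\<^sup>2 + 2 * r * ?m"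
      unfolding n2 B1_def
      by (simp add: inner_add_left inner_add_right inner_z power2_eq_square distrib_left
          inner_commute[of "z *\<^sub>C _" w])
    have nA1: "(norm (A1 w))\<^sup>2 = r\<^sup>2 * (norm (v w))\<^sup>2 + (norm w)\<^sup>2 + 2 * r * ?m"
      unfolding n2 A1_def
      by (simp add: inner_add_left inner_add_right inner_z power2_eq_square distrib_left
          inner_commute[of "z *\<^sub>C _" "v w"] i1[of w "z *\<^sub>C w"] opv)
    have npB1: "(norm (cadjoint v (v (B1 w))))\<^sup>2
        = (norm (v w))\<^sup>2 + r\<^sup>2 * (norm (cadjoint v w))\<^sup>2 + 2 * r * ?m"
    proof -
      have "inner (cadjoint v (v w)) (z *\<^sub>C cadjoint v w) = ?m"
        by (simp add: inner_cadjoint[OF b(1)] i1 opv)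
      moreover have "inner (cadjoint v (v w)) (cadjoint v (v w)) = inner (v w) (v w)"
        by (simp add: inner_cadjoint[OF b(1)] opv)
      ultimately show ?thesis
        unfolding n2 B1_def opv
        by (simp add: inner_add_left inner_add_right inner_z power2_eq_square distrib_left
            inner_commute[of "z *\<^sub>C _" "cadjoint v (v w)"])
    qed
    have nqA1: "(norm (v (cadjoint v (A1 w))))\<^sup>2
        = r\<^sup>2 * (norm (v w))\<^sup>2 + (norm (cadjoint v w))\<^sup>2 + 2 * r * ?m"
    proof -
      have "inner (v w) (z *\<^sub>C v (cadjoint v w)) = ?m"
        by (simp add: i1 opv)
      moreover have "inner (v (cadjoint v w)) (v (cadjoint v w)) = inner (cadjoint v w) (cadjoint v w)"
        by (simp add: i1 opv)
      ultimately show ?thesis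
        unfolding n2 A1_def opv
        by (simp add: inner_add_left inner_add_right inner_z power2_eq_square distrib_left
            inner_commute[of "z *\<^sub>C _" "v w"])
    qed
    have "inner x (cadjoint v (v x)) = (norm (cadjoint v (v x)))\<^sup>2" for x
      unfolding n2 by (simp add: inner_cadjoint[OF b(1)] i1[symmetric] opv)
    then have nB: "(norm (B w))\<^sup>2 = (norm (B1 w))\<^sup>2 + ?k * (norm (cadjoint v (v (B1 w))))\<^sup>2"
      unfolding B_def P_def o_def by (rule norm2_add_scaled_projection)
    have "inner x (v (cadjoint v x)) = (norm (v (cadjoint v x)))\<^sup>2" for x
      unfolding n2 by (simp add: i1 inner_cadjoint[OF b(1), symmetric] opv)
    then have nA: "(norm (A w))\<^sup>2 = (norm (A1 w))\<^sup>2 + ?k * (norm (v (cadjoint v (A1 w))))\<^sup>2"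
      unfolding A_def Q_def o_def by (rule norm2_add_scaled_projection)
    have "(1 + c)\<^sup>2 * (1 - r\<^sup>2) = 1" using inv s(2) by (metis power_mult_distrib power_one)
    then have k: "r\<^sup>2 + ?k * r\<^sup>2 = ?k" by (simp add: algebra_simps)
    have "(norm (A w))\<^sup>2 - (norm (B w))\<^sup>2
      = (r\<^sup>2 + ?k * r\<^sup>2 - ?k) * ((norm (v w))\<^sup>2 - (norm (cadjoint v w))\<^sup>2)"
      unfolding nA nB nA1 nB1 npB1 nqA1 by algebra
    then have "(norm (A w))\<^sup>2 = (norm (B w))\<^sup>2" using k by simp
    then show ?thesis by (simp add: power2_eq_iff_nonneg)
  qed
  obtain u where u: "u \<in> M" "is_unitary u" "\<And>x. u (B x) = A x"
    using unitary_quotient[OF M AB bij norm_eq] by blast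
  \<comment> \<open>The equation for \<open>y\<close> says that \<open>B1\<close> maps it to \<Phi>.
    As \<Phi> lies in the range of v* v, \<open>P c\<close> stretches it by 1 / s, so
    \<open>B\<close> maps s y to \<Phi>.\<close>
  have "B1 (s *\<^sub>R y) = s *\<^sub>R \<Phi>"
    unfolding y[symmetric] B1_def by (simp add: opv scaleR_scaleC scaleC_scaleC scaleC_add_right ac_simps)
  then have "B (s *\<^sub>R y) = ((1 + c) * s) *\<^sub>R \<Phi>"
    by (simp add: B_def P_def opv \<Phi> scaleR_add_left distrib_right)
  then have uA: "u \<Phi> = A (s *\<^sub>R y)" using u(3) inv by (metis scaleR_one)
  \<comment> \<open>The vector v \<Phi> lies in the range of v v*, so against it this projection
    disappears and \<open>Q c\<close> acts as the scalar 1 + c.\<close>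
  have q: "inner (v \<Phi>) (v (cadjoint v x)) = inner (v \<Phi>) x" for x
    by (simp add: i1 inner_cadjoint[OF b(1), symmetric] \<Phi>)
  have "A1 (s *\<^sub>R y) = s *\<^sub>R A1 y"
    unfolding A1_def by (simp add: opv scaleR_scaleC scaleC_scaleC scaleC_add_right ac_simps)
  then have "inner (v \<Phi>) (u \<Phi>) = ((1 + c) * s) * inner (v \<Phi>) (A1 y)"
    unfolding uA A_def Q_def by (simp add: opv inner_add_right q algebra_simps)
  also have "\<dots> = r * inner (v \<Phi>) (v y) + inner (v \<Phi>) (z *\<^sub>C y)"
    by (simp add: inv A1_def inner_add_right)
  also have "v y = v \<Phi> - r *\<^sub>R v (cadjoint v (z *\<^sub>C y))"
    unfolding y[symmetric] by (simp add: opv)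
  also have "inner (v \<Phi>) \<dots> = (norm (v \<Phi>))\<^sup>2 - r * inner (v \<Phi>) (z *\<^sub>C y)"
    by (simp add: inner_diff_right q power2_norm_eq_inner)
  finally have "inner (v \<Phi>) (u \<Phi>) = r * (norm (v \<Phi>))\<^sup>2 + (1 - r\<^sup>2) * inner (v \<Phi>) (z *\<^sub>C y)"
    by (simp add: power2_eq_square algebra_simps)
  with u that show ?thesis by blast
qed

text \<open>Averaging over roots of unity z, the vectors z y(z) of the Moebius formula have a tiny
  mean, so for some z the inner product of v \<Phi> with z y(z) is almost nonnegative. The formula
  then puts that of v \<Phi> with u \<Phi> near 1, which for unit vectors means closeness.\<close>

lemma unitary_approximates_partial_isometry:
  assumes \<Phi>: "norm \<Phi> = 1" "norm (v \<Phi>) = 1" and "\<epsilon> > 0"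
  obtains u where "u \<in> M" "is_unitary u" "norm (v \<Phi> - u \<Phi>) < \<epsilon>"
proof -
  note b = partial_isometry_bounded partial_isometry_cadjoint_bounded
  have "norm (cadjoint v (v \<Phi>)) = 1" using norm_partial_isometry[OF v(2)] \<Phi> by metis
  moreover have "inner \<Phi> (cadjoint v (v \<Phi>)) = (norm (v \<Phi>))\<^sup>2"
    using inner_cadjoint[OF b(1), of "v \<Phi>" \<Phi>] by (simp add: power2_norm_eq_inner inner_commute)
  ultimately have "(norm (\<Phi> - cadjoint v (v \<Phi>)))\<^sup>2 = 0"
    using \<Phi> dot_norm_neg[of \<Phi> "cadjoint v (v \<Phi>)"] by simp
  then have p\<Phi>: "cadjoint v (v \<Phi>) = \<Phi>" by simp
  \<comment> \<open>The final estimate is 2 - 2 (1 - 3 d) = 6 d for the squared distance. The cap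
    1/2 keeps \<open>r\<close> nonnegative and r^n at most 1/2.\<close>
  define d where "d = min (1/2) (\<epsilon>\<^sup>2 / 7)"
  have d: "0 < d" "d \<le> 1/2" "6 * d < \<epsilon>\<^sup>2"
    using \<open>\<epsilon> > 0\<close> unfolding d_def by (auto simp: min_def)
  define r where "r = 1 - d"
  have r: "0 \<le> r" "r < 1" using d by (auto simp: r_def)
  obtain m where m: "r ^ m < d" using real_arch_pow_inv[OF d(1) r(2)] by blast
  define n where "n = Suc m"
  have rn: "0 \<le> r ^ n" "r ^ n \<le> 1/2"
    using m d r mult_left_le_one_le[of "r ^ m" r] by (auto simp: n_def)
  define T where "T = (\<lambda>x. - (r *\<^sub>R cadjoint v x))"
  have "T = (\<lambda>x. complex_of_real (- r) *\<^sub>C cadjoint v x)"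
    unfolding T_def by (simp add: scaleR_scaleC scaleC_minus_left)
  then have Tb: "T \<in> bounded_operators" by (simp add: bounded_operators_scaleC[OF b(2)])
  have Tn: "norm ((T ^^ k) x) \<le> r ^ k * norm x" for k x
  proof (induction k)
    case (Suc k)
    have "norm (T ((T ^^ k) x)) \<le> r * norm ((T ^^ k) x)"
      unfolding T_def using r norm_partial_isometry_cadjoint_le by (simp add: mult_left_mono)
    also have "\<dots> \<le> r * (r ^ k * norm x)" using Suc r by (intro mult_left_mono)
    finally show ?case by simp
  qed simp
  \<comment> \<open>Writing \<Phi> as \<xi> - T^n \<xi> makes the geometric series finite and exact:
    for z^n = 1, summing z^k T^k \<xi> over k < n inverts 1 - z T = 1 + r z v* at \<Phi>.\<close>
  have "bij (\<lambda>x. x - (T ^^ n) x)"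
    by (rule bij_id_minus_contraction[where r = "r ^ n"])
      (use Tn rn bounded_operators_funpow[OF Tb] in auto)
  then obtain \<xi> where \<xi>: "\<Phi> = \<xi> - (T ^^ n) \<xi>" by (metis bij_is_surj surjD)
  have "norm \<xi> \<le> norm \<Phi> + norm ((T ^^ n) \<xi>)" unfolding \<xi> by (metis add.commute norm_triangle_sub)
  also have "norm ((T ^^ n) \<xi>) \<le> 1/2 * norm \<xi>"
    using Tn[of n \<xi>] mult_right_mono[OF rn(2), of "norm \<xi>"] by simp
  finally have norm\<xi>: "norm \<xi> \<le> 2" using \<Phi> by simp
  define R where "R = {z::complex. z ^ n = 1}"
  have R: "finite R" "card R = n" "n > 0"
    unfolding R_def using finite_roots_unity[of n] card_roots_unity_eq[of n] by (auto simp: n_def simp del: power_Suc)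
  define y where "y z = (\<Sum>k<n. z ^ k *\<^sub>C (T ^^ k) \<xi>)" for z
  have y: "y z + r *\<^sub>R z *\<^sub>C cadjoint v (y z) = \<Phi>" if "z \<in> R" for z
  proof -
    have "r *\<^sub>R z *\<^sub>C cadjoint v (y z) = - (z *\<^sub>C T (y z))"
      by (simp add: T_def scaleR_scaleC scaleC_scaleC mult.commute)
    also have "z *\<^sub>C T (y z) = (\<Sum>k<n. z ^ Suc k *\<^sub>C (T ^^ Suc k) \<xi>)"
      by (simp add: y_def op_sum[OF Tb] op_scaleC[OF Tb] scaleC_sum_right scaleC_scaleC)
    finally have "y z + r *\<^sub>R z *\<^sub>C cadjoint v (y z)
        = (\<Sum>k<n. z ^ k *\<^sub>C (T ^^ k) \<xi> - z ^ Suc k *\<^sub>C (T ^^ Suc k) \<xi>)"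
      by (simp only: y_def sum_subtractf) simp
    also have "\<dots> = \<xi> - z ^ n *\<^sub>C (T ^^ n) \<xi>"
      by (subst sum_lessThan_telescope') simp
    finally show ?thesis using that \<xi> by (simp add: R_def)
  qed
  \<comment> \<open>The extra factor z shifts the exponents to 1, ..., n. Only the exponent n
    survives the summation, that is k = m, whose term is bounded by the small r^m.\<close>
  have "(\<Sum>z\<in>R. z *\<^sub>C y z) = (\<Sum>k<n. (\<Sum>z\<in>R. z ^ Suc k) *\<^sub>C (T ^^ k) \<xi>)"
    unfolding y_def scaleC_sum_right scaleC_sum_left scaleC_scaleC
    by (subst sum.swap) simp
  also have "\<dots> = (\<Sum>k<n. if k = m then of_nat n *\<^sub>C (T ^^ m) \<xi> else 0)"
  proof (rule sum.cong)
    fix k assume "k \<in> {..<n}"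
    then have "(\<Sum>z\<in>R. z ^ Suc k) = (if k = m then of_nat n else 0)"
      using sum_power_roots_of_unity[of "Suc k" n] R(2)
      by (auto simp: R_def n_def simp del: power_Suc)
    then show "(\<Sum>z\<in>R. z ^ Suc k) *\<^sub>C (T ^^ k) \<xi>
        = (if k = m then of_nat n *\<^sub>C (T ^^ m) \<xi> else 0)"
      by simp
  qed simp
  also have "\<dots> = of_nat n *\<^sub>C (T ^^ m) \<xi>" by (simp add: n_def)
  finally have sum: "(\<Sum>z\<in>R. z *\<^sub>C y z) = real n *\<^sub>R (T ^^ m) \<xi>" by (simp add: scaleR_scaleC)
  have "norm ((T ^^ m) \<xi>) \<le> d * 2"
    using Tn[of m \<xi>] mult_mono[OF less_imp_le[OF m] norm\<xi>] d(1) by simp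
  then have lower: "inner (v \<Phi>) ((T ^^ m) \<xi>) \<ge> - (2 * d)"
    using Cauchy_Schwarz_ineq2[of "v \<Phi>" "(T ^^ m) \<xi>"] \<Phi>(2) by simp
  have "\<exists>z\<in>R. inner (v \<Phi>) (z *\<^sub>C y z) \<ge> - (2 * d)"
  proof (rule ccontr)
    assume "\<not> ?thesis"
    then have "(\<Sum>z\<in>R. inner (v \<Phi>) (z *\<^sub>C y z)) < (\<Sum>z\<in>R. - (2 * d))"
      using R by (intro sum_strict_mono) auto
    then have "real n * inner (v \<Phi>) ((T ^^ m) \<xi>) < real n * (- (2 * d))"
      unfolding inner_sum_right[symmetric] sum using R(2) by simp
    then show False using lower R(3) by (simp only: mult_less_cancel_left_pos of_nat_0_less_iff)
  qed
  then obtain z where z: "z \<in> R" "inner (v \<Phi>) (z *\<^sub>C y z) \<ge> - (2 * d)" by blast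
  have "cmod z = 1"
    using power_eq_1_iff[of z n] z(1) R(3) by (simp add: R_def)
  then obtain u where u: "u \<in> M" "is_unitary u"
    and inner: "inner (v \<Phi>) (u \<Phi>) = r + (1 - r\<^sup>2) * inner (v \<Phi>) (z *\<^sub>C y z)"
    using moebius_unitary[OF r _ p\<Phi> y[OF z(1)]] \<Phi> by auto
  have "0 \<le> 1 - r\<^sup>2" "1 - r\<^sup>2 \<le> 1" using r by (auto simp: power_le_one)
  then have "(1 - r\<^sup>2) * inner (v \<Phi>) (z *\<^sub>C y z) \<ge> - (2 * d)"
    using mult_left_mono[OF z(2), of "1 - r\<^sup>2"] mult_right_mono[of "1 - r\<^sup>2" 1 "2 * d"] d(1) by linarith
  then have "inner (v \<Phi>) (u \<Phi>) \<ge> 1 - 3 * d" unfolding inner by (simp add: r_def)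
  moreover have "(norm (v \<Phi> - u \<Phi>))\<^sup>2 = 2 - 2 * inner (v \<Phi>) (u \<Phi>)"
    using dot_norm_neg[of "v \<Phi>" "u \<Phi>"] \<Phi> norm_unitary[OF u(2)] by simp
  ultimately have "(norm (v \<Phi> - u \<Phi>))\<^sup>2 < \<epsilon>\<^sup>2" using d(3) by linarith
  then have "norm (v \<Phi> - u \<Phi>) < \<epsilon>" using \<open>\<epsilon> > 0\<close> by (simp add: power2_less_imp_less)
  with u that show ?thesis by blast
qed

end

section \<open>Vectors with equal marginals\<close>

text \<open>A minimizing sequence for the distance from x to the subspace converges to the
  orthogonal projection of x onto its closure. The sequence inside \<open>S\<close> is returned too,
  since its members can be transported from \<Phi> to \<Psi>.\<close>

lemma orthogonal_approximation:
  fixes S :: "'h::chilbert_space set" and x :: 'h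
  assumes "0 \<in> S" and add: "\<And>a b. a \<in> S \<Longrightarrow> b \<in> S \<Longrightarrow> a + b \<in> S"
    and scale: "\<And>c a. a \<in> S \<Longrightarrow> c *\<^sub>C a \<in> S"
  obtains s l where "\<And>n::nat. s n \<in> S" "s \<longlonglongrightarrow> l" "\<And>t. t \<in> S \<Longrightarrow> cinner t (x - l) = 0"
proof -
  have scaleR: "r *\<^sub>R a \<in> S" if "a \<in> S" for r a
    using scale[OF that] by (simp add: scaleR_scaleC)
  define J where "J a = (norm (x - a))\<^sup>2" for a
  have bdd: "bdd_below (J ` S)" by (auto intro!: bdd_belowI[of _ 0] simp: J_def)
  define m where "m = (INF a\<in>S. J a)"
  have m_le: "m \<le> J a" if "a \<in> S" for a unfolding m_def by (rule cINF_lower[OF bdd that])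
  have "\<exists>a\<in>S. J a < m + 1 / Suc n" for n
  proof -
    have "(INF a\<in>S. J a) < m + 1 / Suc n" unfolding m_def by simp
    moreover have "S \<noteq> {}" using \<open>0 \<in> S\<close> by blast
    ultimately show ?thesis using cINF_less_iff[OF _ bdd] by auto
  qed
  then obtain s where s: "\<And>n. s n \<in> S" "\<And>n. J (s n) < m + 1 / Suc n" by metis
  \<comment> \<open>The parallelogram law for x - a and x - b. The midpoint stays in
    \<open>S\<close>, so its distance is bounded below and near-minimizers lie close
    together.\<close>
  have par: "J a + J b = 2 * J ((1/2) *\<^sub>R (a + b)) + (norm (a - b))\<^sup>2 / 2" for a b
    unfolding J_def power2_norm_eq_inner
    by (simp add: inner_add_left inner_add_right inner_diff_left inner_diff_right
        inner_commute[of b a] inner_commute[of a x] inner_commute[of b x] field_simps)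
  have dist_s: "(norm (s n - s k))\<^sup>2 < 2 / Suc n + 2 / Suc k" for n k
    using par[of "s n" "s k"] s(2)[of n] s(2)[of k] m_le[OF scaleR[OF add[OF s(1) s(1)]], of "1/2" n k]
    by simp
  have "Cauchy s"
  proof (rule metric_CauchyI)
    fix e :: real assume e: "e > 0"
    obtain N where N: "inverse (real (Suc N)) < e\<^sup>2 / 4"
      using reals_Archimedean[of "e\<^sup>2 / 4"] e by auto
    show "\<exists>M. \<forall>n\<ge>M. \<forall>k\<ge>M. dist (s n) (s k) < e"
    proof (intro exI allI impI)
      fix n k assume "n \<ge> N" "k \<ge> N"
      then have "2 / real (Suc n) \<le> 2 / real (Suc N)" "2 / real (Suc k) \<le> 2 / real (Suc N)"
        by (auto intro!: divide_left_mono)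
      then have "(norm (s n - s k))\<^sup>2 < e\<^sup>2" using dist_s[of n k] N by (simp add: inverse_eq_divide)
      then show "dist (s n) (s k) < e" using e by (simp add: dist_norm power2_less_imp_less)
    qed
  qed
  then obtain l where l: "s \<longlonglongrightarrow> l" using Cauchy_convergent convergent_def by blast
  have "(\<lambda>n. J (s n)) \<longlonglongrightarrow> J l" unfolding J_def by (intro tendsto_intros l)
  moreover have "(\<lambda>n. m + 1 / Suc n) \<longlonglongrightarrow> m + 0"
    by (rule tendsto_add[OF tendsto_const LIMSEQ_inverse_real_of_nat[unfolded inverse_eq_divide]])
  ultimately have Jl: "J l \<le> m + 0"
    by (rule LIMSEQ_le) (use s(2) less_imp_le in blast)
  have inner0: "inner t (x - l) = 0" if t: "t \<in> S" for t
  proof (cases "t = 0")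
    case False
    \<comment> \<open>The optimal step along \<open>t\<close>: it would push \<open>J\<close> below
      its infimum unless the inner product vanishes.\<close>
    define q where "q = inner t (x - l) / inner t t"
    have "(\<lambda>n. J (s n + q *\<^sub>R t)) \<longlonglongrightarrow> J (l + q *\<^sub>R t)" unfolding J_def by (intro tendsto_intros l)
    then have "m \<le> J (l + q *\<^sub>R t)"
      by (rule LIMSEQ_le_const) (use m_le add s(1) scaleR[OF t] in blast)
    moreover have "J (l + q *\<^sub>R t) = J l - (inner t (x - l))\<^sup>2 / inner t t"
    proof -
      have "J (l + q *\<^sub>R t) = J l - 2 * q * inner t (x - l) + q\<^sup>2 * inner t t"
        unfolding J_def power2_norm_eq_inner
        by (simp add: inner_add_left inner_add_right inner_diff_left inner_diff_right
            inner_commute[of t x] inner_commute[of t l] inner_commute[of l x] power2_eq_square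
            algebra_simps)
      then show ?thesis using False by (simp add: q_def power2_eq_square field_simps)
    qed
    ultimately have "(inner t (x - l))\<^sup>2 / inner t t \<le> 0" using Jl by linarith
    moreover have "inner t t > 0" using False by simp
    ultimately show ?thesis by (simp add: divide_le_0_iff)
  qed simp
  have "cinner t (x - l) = 0" if t: "t \<in> S" for t
  proof (rule complex_eqI)
    show "Re (cinner t (x - l)) = Re 0" using inner0[OF t] by (simp add: inner_eq_Re_cinner)
    show "Im (cinner t (x - l)) = Im 0"
      using inner0[OF scale[OF t, of "\<i>"]] by (simp add: inner_eq_Re_cinner cinner_scaleC_left)
  qed
  with that s(1) l show ?thesis by blast
qed

lemma tendsto_cinner_left:
  fixes f :: "nat \<Rightarrow> 'h::complex_inner"
  assumes "f \<longlonglongrightarrow> l"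
  shows "(\<lambda>n. cinner a (f n)) \<longlonglongrightarrow> cinner a l"
proof -
  have "cinner a y = Complex (inner a y) (inner (\<i> *\<^sub>C a) y)" for y
    by (simp add: complex_eq_iff inner_eq_Re_cinner cinner_scaleC_left)
  then show ?thesis using assms by (auto intro!: tendsto_intros)
qed

text \<open>
  The operator \<open>v\<close> is the closure of \<open>a \<Phi> \<mapsto> a \<Psi>\<close>, extended by \<open>0\<close> to the orthogonal complement;
  the relation \<open>C\<close> in the proof describes its graph.
\<close>

lemma partial_isometry_if_marginals_eq:
  fixes M :: "('h::chilbert_space \<Rightarrow> 'h) set"
  assumes M: "von_neumann_algebra M" and marg: "marginal M \<Psi> = marginal M \<Phi>"
  obtains v where "v \<in> commutant M" "is_partial_isometry v" "\<Psi> = v \<Phi>"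
proof -
  have marg': "cinner \<Psi> (a \<Psi>) = cinner \<Phi> (a \<Phi>)" if "a \<in> M" for a
    using fun_cong[OF marg, of a] that by (simp add: marginal_def)
  have iso: "cinner (a \<Psi>) (b \<Psi>) = cinner (a \<Phi>) (b \<Phi>)" if "a \<in> M" "b \<in> M" for a b
    using marg'[OF vn_comp[OF M vn_cadjoint[OF M that(1)] that(2)]] vn_bounded[OF M that(1)]
    by (simp add: cinner_cadjoint_right)
  have norm_iso: "norm (a \<Psi>) = norm (a \<Phi>)" if "a \<in> M" for a
    using iso[OF that that] by (simp add: norm_eq_sqrt_inner inner_eq_Re_cinner)
  \<comment> \<open>The relation says that y lies in the closure of the orbit of \<Psi> and has the
    pairings required of v x. Components of x orthogonal to the orbit of \<Phi> do not affect these
    pairings, so the extension by 0 is built in.\<close>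
  define C where "C x y \<longleftrightarrow> (\<exists>a. (\<forall>n::nat. a n \<in> M) \<and> (\<lambda>n. a n \<Psi>) \<longlonglongrightarrow> y) \<and>
    (\<forall>b\<in>M. cinner (b \<Psi>) y = cinner (b \<Phi>) x)" for x y
  have C_add: "C (x + x') (y + y')" if C: "C x y" "C x' y'" for x x' y y'
  proof -
    obtain a where "\<And>n. a n \<in> M" "(\<lambda>n. a n \<Psi>) \<longlonglongrightarrow> y"
      using C(1) unfolding C_def by blast
    moreover obtain a' where "\<And>n. a' n \<in> M" "(\<lambda>n. a' n \<Psi>) \<longlonglongrightarrow> y'"
      using C(2) unfolding C_def by blast
    ultimately have "(\<forall>n. (\<lambda>x. a n x + a' n x) \<in> M) \<and> (\<lambda>n. a n \<Psi> + a' n \<Psi>) \<longlonglongrightarrow> y + y'"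
      using vn_add[OF M] by (auto intro: tendsto_add)
    then show ?thesis using C unfolding C_def
      by (auto simp: cinner_add_right intro: exI[of _ "\<lambda>n x. a n x + a' n x"])
  qed
  have C_comp: "C (f x) (f y)" if C: "C x y" and f: "f \<in> M" for x y f
  proof -
    obtain a where "\<And>n. a n \<in> M" "(\<lambda>n. a n \<Psi>) \<longlonglongrightarrow> y" using C unfolding C_def by blast
    then have "(\<forall>n. f \<circ> a n \<in> M) \<and> (\<lambda>n. (f \<circ> a n) \<Psi>) \<longlonglongrightarrow> f y"
      using vn_comp[OF M f] bounded_linear.tendsto[OF op_bounded_linear[OF vn_bounded[OF M f]]] by simp
    moreover have "cinner (b \<Psi>) (f y) = cinner (b \<Phi>) (f x)" if b: "b \<in> M" for b
    proof -
      have "cinner ((cadjoint f \<circ> b) \<Psi>) y = cinner ((cadjoint f \<circ> b) \<Phi>) x"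
        using C vn_comp[OF M vn_cadjoint[OF M f] b] unfolding C_def by blast
      then show ?thesis by (simp add: cinner_cadjoint[OF vn_bounded[OF M f]])
    qed
    ultimately show ?thesis
      unfolding C_def by (intro conjI ballI exI[of _ "\<lambda>n. f \<circ> a n"]) blast+
  qed
  have scale_mem: "(\<lambda>x. c *\<^sub>C x) \<in> M" for c using vn_scaleC[OF M vn_id[OF M]] by simp
  \<comment> \<open>Approximating y by a n \<Psi>, whose pairing with y equals that of a n \<Phi>
    with x, bounds the squared norm of y by norm y times norm x.\<close>
  have C_norm: "norm y \<le> norm x" if C: "C x y" for x y
  proof -
    obtain a where a: "\<And>n. a n \<in> M" "(\<lambda>n. a n \<Psi>) \<longlonglongrightarrow> y" using C unfolding C_def by blast
    have "inner (a n \<Psi>) y \<le> norm (a n \<Psi>) * norm x" for n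
      using C a(1)[of n] norm_iso[OF a(1)[of n]] norm_cauchy_schwarz[of "a n \<Phi>" x]
      unfolding C_def by (simp add: inner_eq_Re_cinner)
    then have "inner y y \<le> norm y * norm x"
      by (intro LIMSEQ_le[OF tendsto_inner[OF a(2) tendsto_const]
            tendsto_mult[OF tendsto_norm[OF a(2)] tendsto_const]]) auto
    then have "norm y * norm y \<le> norm y * norm x" by (simp flip: power2_norm_eq_inner power2_eq_square)
    then show ?thesis by (cases "norm y = 0") auto
  qed
  have C_unique: "y = y'" if "C x y" "C x y'" for x y y'
  proof -
    have "C (x + (- 1) *\<^sub>C x) (y + (- 1) *\<^sub>C y')"
      by (rule C_add[OF that(1) C_comp[OF that(2) scale_mem]])
    then show ?thesis using C_norm[of 0 "y - y'"] by (simp add: scaleC_minus_left)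
  qed
  \<comment> \<open>Project x to the closed orbit of \<Phi>. The approximants a n \<Phi> converge,
    so by isometry the a n \<Psi> are Cauchy; their limit is y.\<close>
  have "\<exists>y. C x y" for x
  proof -
    let ?S = "(\<lambda>a. a \<Phi>) ` M"
    obtain s l where s: "\<And>n::nat. s n \<in> ?S" "s \<longlonglongrightarrow> l" "\<And>t. t \<in> ?S \<Longrightarrow> cinner t (x - l) = 0"
    proof (rule orthogonal_approximation[of ?S x])
      show "0 \<in> ?S" using imageI[OF scale_mem[of 0], of "\<lambda>a. a \<Phi>"] by simp
      fix s t c assume "s \<in> ?S" "t \<in> ?S"
      then obtain f g where f: "f \<in> M" "s = f \<Phi>" and g: "g \<in> M" "t = g \<Phi>" by blast
      show "s + t \<in> ?S" using imageI[OF vn_add[OF M f(1) g(1)], of "\<lambda>a. a \<Phi>"] f g by simp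
      show "c *\<^sub>C s \<in> ?S" using imageI[OF vn_scaleC[OF M f(1)], of "\<lambda>a. a \<Phi>"] f by simp
    qed (rule that)
    from s(1) have "\<forall>n. \<exists>a. a \<in> M \<and> s n = a \<Phi>" by blast
    from choice[OF this] obtain a where a: "\<And>n. a n \<in> M" "\<And>n. s n = a n \<Phi>" by blast
    have "dist (a n \<Psi>) (a k \<Psi>) = dist (s n) (s k)" for n k
      using norm_iso[OF vn_diff[OF M a(1)[of n] a(1)[of k]]] by (simp add: dist_norm a(2))
    then have "Cauchy (\<lambda>n. a n \<Psi>)" using LIMSEQ_imp_Cauchy[OF s(2)] by (simp add: Cauchy_def)
    then obtain y where y: "(\<lambda>n. a n \<Psi>) \<longlonglongrightarrow> y" using Cauchy_convergent convergent_def by blast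
    have "cinner (b \<Psi>) y = cinner (b \<Phi>) x" if b: "b \<in> M" for b
    proof -
      have "(\<lambda>n. cinner (b \<Psi>) (a n \<Psi>)) \<longlonglongrightarrow> cinner (b \<Psi>) y" by (rule tendsto_cinner_left[OF y])
      moreover have "(\<lambda>n. cinner (b \<Psi>) (a n \<Psi>)) \<longlonglongrightarrow> cinner (b \<Phi>) l"
        using tendsto_cinner_left[OF s(2)] by (simp add: iso[OF b a(1)] a(2)[symmetric])
      ultimately have "cinner (b \<Psi>) y = cinner (b \<Phi>) l" by (rule LIMSEQ_unique)
      then show ?thesis using s(3)[of "b \<Phi>"] b by (simp add: cinner_diff_right)
    qed
    with a(1) y show ?thesis unfolding C_def by (intro exI[of _ y] conjI ballI exI[of _ a]) auto
  qed
  then obtain v where v: "\<And>x. C x (v x)" by metis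
  have v_eq: "v x = y" if "C x y" for x y using C_unique[OF v that] .
  have vb: "v \<in> bounded_operators"
    using v_eq[OF C_add[OF v v]] v_eq[OF C_comp[OF v scale_mem]] C_norm[OF v]
    by (intro bounded_operatorsI[where K = 1]) auto
  have comm: "v (a x) = a (v x)" if "a \<in> M" for a x by (rule v_eq[OF C_comp[OF v that]])
  then have vM: "v \<in> commutant M" using vb by (auto simp: commutant_def)
  have "C \<Phi> \<Psi>" unfolding C_def
    using vn_id[OF M] iso[OF _ vn_id[OF M]] by (auto intro: exI[of _ "\<lambda>_. id"])
  then have v\<Phi>: "v \<Phi> = \<Psi>" by (rule v_eq)
  \<comment> \<open>Pairing b \<Phi> with v* v x gives the pairing of v (b \<Phi>) = b \<Psi> with v
    x, so v* v x is also related to v x. Uniqueness yields v v* v = v, which makes v* v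
    idempotent.\<close>
  have "C (cadjoint v (v x)) (v x)" for x
    using v[of x] comm v\<Phi> unfolding C_def by (auto simp: cinner_cadjoint_right[OF vb])
  then have vvv: "v (cadjoint v (v x)) = v x" for x by (rule v_eq)
  have "is_partial_isometry v"
    unfolding is_partial_isometry_def is_projection_def
    by (auto simp: vb bounded_operators_comp cadjoint_bounded_operators cadjoint_comp
        cadjoint_cadjoint vvv)
  with that vM v\<Phi> show ?thesis by blast
qed

section \<open>Haag duality\<close>

theorem theorem6p19:
  fixes M\<^sub>A M\<^sub>B :: "('h::chilbert_space \<Rightarrow> 'h) set"
  assumes "separable_space (euclidean :: 'h topology)"
    and "von_neumann_algebra M\<^sub>A"
    and "von_neumann_algebra M\<^sub>B"
    and "\<forall>a\<in>M\<^sub>A. \<forall>b\<in>M\<^sub>B. a \<circ> b = b \<circ> a"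
  shows
    "(M\<^sub>A = commutant M\<^sub>B \<longleftrightarrow>
        (\<forall>\<Psi> \<Phi>. norm \<Psi> = 1 \<and> norm \<Phi> = 1 \<and> marginal M\<^sub>A \<Psi> = marginal M\<^sub>A \<Phi> \<longrightarrow>
          (\<exists>v\<^sub>B\<in>M\<^sub>B. is_partial_isometry v\<^sub>B \<and> \<Psi> = v\<^sub>B \<Phi>))) \<and>
     (M\<^sub>A = commutant M\<^sub>B \<longleftrightarrow>
        (\<forall>\<Psi> \<Phi>. norm \<Psi> = 1 \<and> norm \<Phi> = 1 \<and> marginal M\<^sub>A \<Psi> = marginal M\<^sub>A \<Phi> \<longrightarrow>
          (\<forall>\<epsilon>>0. \<exists>u\<^sub>B\<in>M\<^sub>B. is_unitary u\<^sub>B \<and> norm (\<Psi> - u\<^sub>B \<Phi>) < \<epsilon>)))"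
proof -
  let ?eq = "\<lambda>\<Psi> \<Phi>. norm \<Psi> = 1 \<and> norm \<Phi> = 1 \<and> marginal M\<^sub>A \<Psi> = marginal M\<^sub>A \<Phi>"
  note A = assms(2) and B = assms(3)
  \<comment> \<open>Conditions (b) and (c) both weaken to approximation by contractions: a partial
    isometry attains error 0, a unitary preserves norms.\<close>
  have haag: "M\<^sub>A = commutant M\<^sub>B"
    if approx: "\<And>\<Psi> \<Phi> \<epsilon>. ?eq \<Psi> \<Phi> \<Longrightarrow> \<epsilon> > 0 \<Longrightarrow>
      \<exists>b\<in>M\<^sub>B. (\<forall>x. norm (b x) \<le> norm x) \<and> norm (\<Psi> - b \<Phi>) < \<epsilon>"
  proof
    show "M\<^sub>A \<subseteq> commutant M\<^sub>B" using assms(4) vn_bounded[OF A] by (auto simp: commutant_def)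
    have "commutant M\<^sub>A \<subseteq> M\<^sub>B" using commutant_subset_if_approximable[OF A B] approx by blast
    then have "commutant M\<^sub>B \<subseteq> commutant (commutant M\<^sub>A)" by (auto simp: commutant_def)
    then show "commutant M\<^sub>B \<subseteq> M\<^sub>A" using A by (simp add: von_neumann_algebra_def)
  qed
  \<comment> \<open>Taking commutants turns the duality around, so operators found in the commutant
    of \<open>M\<^sub>A\<close> belong to \<open>M\<^sub>B\<close>.\<close>
  have duality: "M\<^sub>B = commutant M\<^sub>A" if "M\<^sub>A = commutant M\<^sub>B"
    using that B by (simp add: von_neumann_algebra_def)
  have b: "\<exists>v\<in>M\<^sub>B. is_partial_isometry v \<and> \<Psi> = v \<Phi>" if "M\<^sub>A = commutant M\<^sub>B" "?eq \<Psi> \<Phi>" for \<Psi> \<Phi>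
    using partial_isometry_if_marginals_eq[OF A, of \<Psi> \<Phi>] that(2) duality[OF that(1)] by blast
  have c: "\<exists>u\<in>M\<^sub>B. is_unitary u \<and> norm (\<Psi> - u \<Phi>) < \<epsilon>"
    if h: "M\<^sub>A = commutant M\<^sub>B" "?eq \<Psi> \<Phi>" "\<epsilon> > 0" for \<Psi> \<Phi> \<epsilon>
  proof -
    obtain v where v: "v \<in> M\<^sub>B" "is_partial_isometry v" "\<Psi> = v \<Phi>" using b[OF h(1,2)] by blast
    show ?thesis
      using unitary_approximates_partial_isometry[OF B v(1,2), of \<Phi> \<epsilon>] h(2,3) v(3) by blast
  qed
  have b': "M\<^sub>A = commutant M\<^sub>B"
    if H: "\<And>\<Psi> \<Phi>. ?eq \<Psi> \<Phi> \<Longrightarrow> \<exists>v\<in>M\<^sub>B. is_partial_isometry v \<and> \<Psi> = v \<Phi>"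
  proof (rule haag)
    fix \<Psi> \<Phi> and \<epsilon> :: real assume eq: "?eq \<Psi> \<Phi>" and "\<epsilon> > 0"
    obtain v where "v \<in> M\<^sub>B" "is_partial_isometry v" "\<Psi> = v \<Phi>" using H[OF eq] by blast
    then show "\<exists>b\<in>M\<^sub>B. (\<forall>x. norm (b x) \<le> norm x) \<and> norm (\<Psi> - b \<Phi>) < \<epsilon>"
      using norm_partial_isometry_le \<open>\<epsilon> > 0\<close> by (intro bexI[of _ v]) auto
  qed
  have c': "M\<^sub>A = commutant M\<^sub>B"
    if H: "\<And>\<Psi> \<Phi> \<epsilon>. ?eq \<Psi> \<Phi> \<Longrightarrow> \<epsilon> > 0 \<Longrightarrow> \<exists>u\<in>M\<^sub>B. is_unitary u \<and> norm (\<Psi> - u \<Phi>) < \<epsilon>"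
  proof (rule haag)
    fix \<Psi> \<Phi> and \<epsilon> :: real assume eq: "?eq \<Psi> \<Phi>" "\<epsilon> > 0"
    obtain u where "u \<in> M\<^sub>B" "is_unitary u" "norm (\<Psi> - u \<Phi>) < \<epsilon>" using H[OF eq] by blast
    then show "\<exists>b\<in>M\<^sub>B. (\<forall>x. norm (b x) \<le> norm x) \<and> norm (\<Psi> - b \<Phi>) < \<epsilon>"
      by (intro bexI[of _ u]) (use norm_unitary in \<open>auto intro!: eq_refl\<close>)
  qed
  show ?thesis
  proof (intro conjI iffI allI impI)
    assume H: "\<forall>\<Psi> \<Phi>. ?eq \<Psi> \<Phi> \<longrightarrow> (\<exists>v\<in>M\<^sub>B. is_partial_isometry v \<and> \<Psi> = v \<Phi>)"
    show "M\<^sub>A = commutant M\<^sub>B" by (rule b'[OF H[rule_format]])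
  next
    assume H: "\<forall>\<Psi> \<Phi>. ?eq \<Psi> \<Phi> \<longrightarrow> (\<forall>\<epsilon>>0. \<exists>u\<in>M\<^sub>B. is_unitary u \<and> norm (\<Psi> - u \<Phi>) < \<epsilon>)"
    show "M\<^sub>A = commutant M\<^sub>B" by (rule c'[OF H[rule_format]])
  qed (rule b c; assumption)+
qed

end
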